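(* Square Root can be solved in time $O(n)$ for $n$-vertex graphs of maximum degree at most~$5$.
   Context: A graph $H$ is a square root of a graph $G$ if $G=H^2$, i.e. $G$ is obtained from $H$ by adding an edge between any two vertices of $H$ at distance~2. The Square Root problem asks whether a given graph admits a square root. *)

theory Defs
  imports
    "Graph_Theory.Pair_Digraph"
    "Graph_Theory.Shortest_Path"
    "HOL-Library.Landau_Symbols"
begin

section \<open>Squares and square roots of graphs\<close>

text \<open>
  Finite simple graphs are the symmetric loop-free pair digraphs of locale \<open>pair_graph\<close>: an
  undirected edge is a pair of opposite arcs, so that \<open>out_degree\<close> is the degree of a vertex.
  With all arc weights equal to 1, \<open>\<mu>\<close> is the ordinary distance (infinite between vertices in
  different components).
\<close>

definition graph_distance :: "'a pair_pre_digraph \<Rightarrow> 'a \<Rightarrow> 'a \<Rightarrow> ereal" where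
  "graph_distance H u v = wf_digraph.\<mu> (with_proj H) (\<lambda>_. 1) u v"

definition graph_square :: "'a pair_pre_digraph \<Rightarrow> 'a pair_pre_digraph" where
  "graph_square H =
     \<lparr> pverts = pverts H,
       parcs = parcs H \<union> {(u, v). u \<in> pverts H \<and> v \<in> pverts H \<and> graph_distance H u v = 2} \<rparr>"

definition has_square_root :: "'a pair_pre_digraph \<Rightarrow> bool" where
  "has_square_root G \<longleftrightarrow> (\<exists>H. pair_graph H \<and> G = graph_square H)"

section \<open>Word RAM\<close>

text \<open>
  Programs are finite lists of instructions with absolute jump targets. The machine has directly
  addressed registers and an indirectly addressed memory; each instruction costs one time unit.
  In \<open>Load\<close> and \<open>Store\<close> the second, respectively first, register holds the memory address.
  Subtraction is truncated, so it also serves for comparisons. The machine halts when the program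
  counter leaves the program.
\<close>

datatype instr =
    Const nat nat
  | Copy nat nat
  | Add nat nat nat
  | Sub nat nat nat
  | Load nat nat
  | Store nat nat
  | Jump nat
  | JumpIfZero nat nat

type_synonym program = "instr list"

record config =
  pc :: nat
  regs :: "nat \<Rightarrow> nat"
  mem :: "nat \<Rightarrow> nat"

fun exec_instr :: "instr \<Rightarrow> config \<Rightarrow> config" where
  "exec_instr (Const r k) c = c\<lparr> pc := pc c + 1, regs := (regs c)(r := k) \<rparr>"
| "exec_instr (Copy r s) c = c\<lparr> pc := pc c + 1, regs := (regs c)(r := regs c s) \<rparr>"
| "exec_instr (Add r s t) c = c\<lparr> pc := pc c + 1, regs := (regs c)(r := regs c s + regs c t) \<rparr>"
| "exec_instr (Sub r s t) c = c\<lparr> pc := pc c + 1, regs := (regs c)(r := regs c s - regs c t) \<rparr>"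
| "exec_instr (Load r s) c = c\<lparr> pc := pc c + 1, regs := (regs c)(r := mem c (regs c s)) \<rparr>"
| "exec_instr (Store r s) c = c\<lparr> pc := pc c + 1, mem := (mem c)(regs c r := regs c s) \<rparr>"
| "exec_instr (Jump l) c = c\<lparr> pc := l \<rparr>"
| "exec_instr (JumpIfZero r l) c = c\<lparr> pc := (if regs c r = 0 then l else pc c + 1) \<rparr>"

definition halted :: "program \<Rightarrow> config \<Rightarrow> bool" where
  "halted P c \<longleftrightarrow> length P \<le> pc c"

definition step :: "program \<Rightarrow> config \<Rightarrow> config" where
  "step P c = (if halted P c then c else exec_instr (P ! pc c) c)"

definition initial_config :: "nat list \<Rightarrow> config" where
  "initial_config xs =
     \<lparr> pc = 0, regs = (\<lambda>_. 0), mem = (\<lambda>a. if a < length xs then xs ! a else 0) \<rparr>"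

definition fits_word_size :: "nat \<Rightarrow> config \<Rightarrow> bool" where
  "fits_word_size w c \<longleftrightarrow> (\<forall>r. regs c r < 2 ^ w) \<and> (\<forall>a. mem c a < 2 ^ w)"

text \<open>
  Started on input \<open>xs\<close>, the program halts after at most \<open>t\<close> steps with the truth value of \<open>b\<close>
  in register 0. No value ever exceeds \<open>w\<close> bits, which rules out the gain in power that
  unit-cost arithmetic on unbounded numbers would give.
\<close>

definition decides_within :: "program \<Rightarrow> nat \<Rightarrow> nat \<Rightarrow> nat list \<Rightarrow> bool \<Rightarrow> bool" where
  "decides_within P w t xs b \<longleftrightarrow>
     (\<exists>k\<le>t. let c = (step P ^^ k) (initial_config xs) in
        halted P c \<and> regs c 0 = (if b then 1 else 0) \<and>
        (\<forall>j\<le>k. fits_word_size w ((step P ^^ j) (initial_config xs))))"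

section \<open>Adjacency-list representation\<close>

text \<open>
  A graph with vertices \<open>0, \<dots>, n - 1\<close> is given by \<open>n\<close>, followed for each vertex in turn by its
  degree and its neighbours. The order of the neighbours is arbitrary, so a graph has several
  representations.
\<close>

definition adjacency_list_rep :: "nat \<Rightarrow> nat pair_pre_digraph \<Rightarrow> nat list \<Rightarrow> bool" where
  "adjacency_list_rep n G xs \<longleftrightarrow>
     pverts G = {..<n} \<and>
     (\<exists>adj. (\<forall>v<n. distinct (adj v) \<and> set (adj v) = {u. v \<rightarrow>\<^bsub>with_proj G\<^esub> u}) \<and>
            xs = n # concat (map (\<lambda>v. length (adj v) # adj v) [0..<n]))"

end

theory Submission
  imports Defs "HOL-Real_Asymp.Real_Asymp"
begin

text \<open>
  If \<open>G = H\<^sup>2\<close> has maximum degree at most 5, every ball of radius 2 in \<open>H\<close> has at most 6 vertices.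
  Such an \<open>H\<close> can hardly branch: a vertex at depth at least 2 from a start vertex has at most 3
  descendants at every deeper level, so all spheres of \<open>H\<close>, and hence all breadth-first layers of
  \<open>G\<close>, have bounded size. Consequently, adjacent vertices are fewer than 72 places apart in any
  breadth-first order of \<open>G\<close>. For an order of bounded bandwidth, being a square is a condition on
  windows of bounded length, once the neighbourhoods in \<open>H\<close> are guessed; a finite automaton, obtained
  by the subset construction, tracks the possible guesses. The program computes a breadth-first order
  and runs the automaton, whose transition table is hard-wired, on the relative positions of the
  neighbours of each vertex. Arcs that are too long make the automaton reject.
\<close>

section \<open>Square roots as relations\<close>

text \<open>The number 72 is 2 * 2 * 18. A sphere of \<open>H\<close> has at most 18 vertices: at
  most 6 at depth 2, each with at most 3 descendants at any deeper level. A sphere of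
  \<open>G\<close> with positive radius is covered by two consecutive spheres of \<open>H\<close>,
  and everything from the head of the queue onwards lies in two consecutive spheres of
  \<open>G\<close>. All of this presupposes a root, which the input need not have. The search itself
  needs no such promise: it is linear because degrees are at most 5. The bandwidth bound enters only
  to justify rejection: an arc that is too long refutes every root. So the window can have a fixed
  length, and the number of automaton states, though enormous, does not depend on the number of
  vertices.\<close>

definition is_root :: "('a \<times> 'a) set \<Rightarrow> ('a \<times> 'a) set \<Rightarrow> bool" where
  "is_root R E \<longleftrightarrow> sym R \<and> irrefl R \<and> E = R\<^sup>= O R\<^sup>= - Id"

text \<open>\<open>\<mu>\<close> is an infimum over walks in the extended reals. Unit costs make it
  an infimum of natural numbers, hence attained as soon as a walk exists, so walks of length 0, 1
  and 2 decide the matter.\<close>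

lemma graph_distance_eq_2_iff:
  assumes "pair_graph H"
  shows "graph_distance H u v = 2 \<longleftrightarrow>
    u \<noteq> v \<and> (u, v) \<notin> parcs H \<and> (u, v) \<in> parcs H O parcs H"
proof -
  interpret H: pair_graph H by fact
  have cost: "H.awalk_cost (\<lambda>_. 1) p = real (length p)" for p
    by (induction p) auto
  define P where "P = {p. H.awalk u p v}"
  define D where "D = H.\<mu> (\<lambda>_. 1) u v"
  have D: "D = (INF p\<in>P. ereal (length p))"
    by (simp add: D_def H.\<mu>_def P_def cost)
  have le: "D \<le> ereal (length p)" if "p \<in> P" for p
    unfolding D using that by (rule INF_lower)
  have attained: "\<exists>p\<in>P. D = ereal (length p)" if "P \<noteq> {}"
  proof -
    have "is_arg_min length (\<lambda>p. p \<in> P) (arg_min length (\<lambda>p. p \<in> P))"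
      using that is_arg_min_arg_min_nat[of "\<lambda>p. p \<in> P"] by blast
    then show ?thesis
      unfolding D is_arg_min_linorder
      by (intro bexI[of _ "arg_min length (\<lambda>p. p \<in> P)"]) (auto intro!: INF_eqI)
  qed
  have len0: "p = [] \<Longrightarrow> p \<in> P \<Longrightarrow> u = v" for p
    by (auto simp: P_def H.awalk_Nil_iff)
  have len1: "length p = 1 \<Longrightarrow> p \<in> P \<Longrightarrow> (u, v) \<in> parcs H" for p
    by (auto simp: P_def length_Suc_conv H.awalk_Cons_iff H.awalk_Nil_iff)
  have len2: "length p = 2 \<Longrightarrow> p \<in> P \<Longrightarrow> (u, v) \<in> parcs H O parcs H" for p
    by (force simp: P_def length_Suc_conv H.awalk_Cons_iff H.awalk_Nil_iff numeral_2_eq_2)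
  have walk0: "u \<in> pverts H \<Longrightarrow> u = v \<Longrightarrow> [] \<in> P"
    by (auto simp: P_def H.awalk_Nil_iff)
  have walk1: "(u, v) \<in> parcs H \<Longrightarrow> [(u, v)] \<in> P"
    by (auto simp: P_def H.awalk_Cons_iff H.awalk_Nil_iff H.in_arcsD2)
  have walk2: "(u, w) \<in> parcs H \<Longrightarrow> (w, v) \<in> parcs H \<Longrightarrow> [(u, w), (w, v)] \<in> P" for w
    by (auto simp: P_def H.awalk_Cons_iff H.awalk_Nil_iff H.in_arcsD2)
  have "D = 2 \<longleftrightarrow> u \<noteq> v \<and> (u, v) \<notin> parcs H \<and> (u, v) \<in> parcs H O parcs H"
  proof
    assume D2: "D = 2"
    then have "P \<noteq> {}" by (auto simp: D top_ereal_def)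
    then obtain p where p: "p \<in> P" "length p = 2"
      using attained D2 by auto
    have "u \<in> pverts H" using p(1) by (auto simp: P_def H.awalk_def)
    then show "u \<noteq> v \<and> (u, v) \<notin> parcs H \<and> (u, v) \<in> parcs H O parcs H"
      using len2[OF p(2,1)] le[OF walk0] le[OF walk1] D2
      by (auto simp: zero_ereal_def[symmetric] one_ereal_def[symmetric])
  next
    assume r: "u \<noteq> v \<and> (u, v) \<notin> parcs H \<and> (u, v) \<in> parcs H O parcs H"
    then obtain w where "[(u, w), (w, v)] \<in> P" using walk2 by blast
    then have "P \<noteq> {}" "D \<le> 2" using le[of "[(u, w), (w, v)]"] by auto
    then obtain p where p: "p \<in> P" "D = ereal (length p)" "D \<le> 2"
      using attained by blast
    then have "length p \<le> 2" by simp
    moreover have "length p \<noteq> 0" "length p \<noteq> 1" using len0 len1 p r by auto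
    ultimately have "length p = 2" by linarith
    then show "D = 2" using p by simp
  qed
  then show ?thesis by (simp add: graph_distance_def D_def)
qed

lemma parcs_graph_square:
  assumes "pair_graph H"
  shows "parcs (graph_square H) = (parcs H)\<^sup>= O (parcs H)\<^sup>= - Id"
proof -
  interpret H: pair_graph H by fact
  show ?thesis
    unfolding graph_square_def graph_distance_eq_2_iff[OF assms]
    using H.no_loops' H.in_arcsD1 H.in_arcsD2 by auto
qed

lemma is_root_subset: "is_root R E \<Longrightarrow> R \<subseteq> E"
  by (auto simp: is_root_def irrefl_def)

text \<open>\<open>graph_square\<close> keeps the vertices, so only the arcs of a root are unknown.
  That they are arcs of \<open>G\<close> makes the graph built from \<open>R\<close> finite and
  well-formed.\<close>

lemma has_square_root_iff:
  assumes "pair_graph G"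
  shows "has_square_root G \<longleftrightarrow> (\<exists>R. is_root R (parcs G))"
proof
  assume "has_square_root G"
  then obtain H where H: "pair_graph H" "G = graph_square H"
    by (auto simp: has_square_root_def)
  interpret H: pair_graph H by fact
  have "sym (parcs H)" using H.sym_arcs by (simp add: symmetric_def)
  moreover have "irrefl (parcs H)" using H.no_loops by (force simp: irrefl_def)
  ultimately have "is_root (parcs H) (parcs G)"
    using H parcs_graph_square by (simp add: is_root_def)
  then show "\<exists>R. is_root R (parcs G)" by blast
next
  interpret G: pair_graph G by fact
  assume "\<exists>R. is_root R (parcs G)"
  then obtain R where R: "is_root R (parcs G)" by blast
  define H where "H = \<lparr> pverts = pverts G, parcs = R \<rparr>"
  have sub: "R \<subseteq> parcs G" by (rule is_root_subset[OF R])
  have "fst e \<in> pverts G" "snd e \<in> pverts G" "fst e \<noteq> snd e" if "e \<in> R" for e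
    using that sub G.arc_fst_in_verts G.arc_snd_in_verts G.no_loops by auto
  moreover have "finite R" using sub G.pair_finite_arcs by (rule finite_subset)
  moreover have "sym R" using R by (simp add: is_root_def)
  ultimately have "pair_graph H"
    using G.pair_finite_verts
    by unfold_locales (auto simp: H_def symmetric_def arcs_ends_def arc_to_ends_def)
  moreover have "G = graph_square H"
  proof (rule pair_pre_digraph.equality)
    show "parcs G = parcs (graph_square H)"
      using R parcs_graph_square[OF \<open>pair_graph H\<close>] by (auto simp: is_root_def H_def)
  qed (auto simp: graph_square_def H_def)
  ultimately show "has_square_root G" by (auto simp: has_square_root_def)
qed

section \<open>Spheres of a root and of its square\<close>

text \<open>Powers of the reflexive closure are cumulative, so walks with fewer than
  \<open>k\<close> arcs count as well.\<close>

definition ball :: "('a \<times> 'a) set \<Rightarrow> nat \<Rightarrow> 'a \<Rightarrow> 'a set" where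
  "ball R k r = (R\<^sup>= ^^ k) `` {r}"

definition sphere :: "('a \<times> 'a) set \<Rightarrow> nat \<Rightarrow> 'a \<Rightarrow> 'a set" where
  "sphere R k r = ball R k r - (\<Union>j<k. ball R j r)"

lemma ball_0 [simp]: "ball R 0 r = {r}"
  by (simp add: ball_def)

lemma ball_Suc: "ball R (Suc k) r = ball R k r \<union> R `` ball R k r"
  by (auto simp: ball_def)

lemma ball_mono: "j \<le> k \<Longrightarrow> ball R j r \<subseteq> ball R k r"
  by (induction rule: dec_induct) (auto simp: ball_Suc)

lemma ball_add: "ball R (j + k) r = (\<Union>v\<in>ball R j r. ball R k v)"
  by (auto simp: ball_def relpow_add)

lemma self_mem_ball: "r \<in> ball R k r"
  using ball_mono[of 0 k R r] by auto

lemma sphere_Suc: "sphere R (Suc k) r = ball R (Suc k) r - ball R k r"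
proof -
  have "(\<Union>j<Suc k. ball R j r) = ball R k r"
    by (intro equalityI UN_least ball_mono) auto
  then show ?thesis by (simp add: sphere_def)
qed

lemma sphere_0 [simp]: "sphere R 0 r = {r}"
  by (simp add: sphere_def)

lemma sphere_subset_ball: "sphere R k r \<subseteq> ball R k r"
  by (auto simp: sphere_def)

lemma spheres_disjoint: "j \<noteq> k \<Longrightarrow> sphere R j r \<inter> sphere R k r = {}"
  unfolding sphere_def neq_iff by blast

lemma sphere_parent:
  assumes "x \<in> sphere R (Suc k) r"
  obtains y where "y \<in> sphere R k r" "(y, x) \<in> R"
proof -
  obtain y where y: "y \<in> ball R k r" "(y, x) \<in> R"
    using assms by (auto simp: sphere_Suc ball_Suc)
  have "y \<notin> ball R j r" if "j < k" for j
  proof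
    assume "y \<in> ball R j r"
    then have "x \<in> ball R (Suc j) r" using y by (auto simp: ball_Suc)
    then show False using assms ball_mono[of "Suc j" k R r] that by (auto simp: sphere_Suc)
  qed
  then show ?thesis using that y by (auto simp: sphere_def)
qed

text \<open>For \<open>v\<close> at depth \<open>k\<close>, these are the vertices at depth
  \<open>k + j\<close> that some shortest walk from \<open>r\<close> reaches through
  \<open>v\<close>.\<close>

definition descendants :: "('a \<times> 'a) set \<Rightarrow> 'a \<Rightarrow> nat \<Rightarrow> nat \<Rightarrow> 'a \<Rightarrow> 'a set" where
  "descendants R r k j v = ball R j v \<inter> sphere R (k + j) r"

text \<open>A walk of \<open>i + j\<close> steps from \<open>v\<close> that gains
  \<open>i + j\<close> levels must gain one level per step: an intermediate vertex less deep than
  expected would bring the end closer to \<open>r\<close>.\<close>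

lemma descendants_add:
  assumes "v \<in> sphere R k r"
  shows "descendants R r k (i + j) v \<subseteq> (\<Union>c\<in>descendants R r k i v. descendants R r (k + i) j c)"
proof
  fix x assume x: "x \<in> descendants R r k (i + j) v"
  then obtain c where c: "c \<in> ball R i v" "x \<in> ball R j c"
    by (auto simp: descendants_def ball_add)
  have "c \<in> ball R (k + i) r"
    using assms sphere_subset_ball[of R k r] c(1) by (auto simp: ball_add)
  moreover have "c \<notin> ball R l r" if "l < k + i" for l
  proof
    assume "c \<in> ball R l r"
    then have "x \<in> ball R (l + j) r" using c(2) by (auto simp: ball_add)
    then show False using x that by (auto simp: descendants_def sphere_def)
  qed
  ultimately have "c \<in> descendants R r k i v"
    using c by (auto simp: descendants_def sphere_def)
  then show "x \<in> (\<Union>c\<in>descendants R r k i v. descendants R r (k + i) j c)"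
    using x c by (auto simp: descendants_def add.assoc)
qed

lemma card_UN_singleton_le:
  "card A \<le> 1 \<Longrightarrow> finite A \<Longrightarrow> (\<And>a. a \<in> A \<Longrightarrow> card (f a) \<le> b) \<Longrightarrow>
    card (\<Union>a\<in>A. f a) \<le> b"
  by (cases "A = {}") (auto simp: le_Suc_eq card_1_singleton_iff)

section \<open>Growth of graphs whose balls of radius 2 have at most six vertices\<close>

locale small_balls =
  fixes R :: "('a \<times> 'a) set"
  assumes sym_R: "sym R"
    and finite_ball_2: "finite (ball R 2 v)"
    and card_ball_2: "card (ball R 2 v) \<le> 6"
begin

lemma finite_ball: "finite (ball R k v)"
proof (induction k)
  case (Suc k)
  have "ball R (Suc k) v = (\<Union>u\<in>ball R k v. ball R 1 u)"
    using ball_add[of R k 1 v] by simp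
  moreover have "finite (ball R 1 u)" for u
    using finite_subset[OF ball_mono[of 1 2 R u] finite_ball_2] by simp
  ultimately show ?case using Suc by simp
qed simp

lemma finite_sphere: "finite (sphere R k v)"
  using finite_ball sphere_subset_ball by (metis finite_subset)

lemma finite_descendants: "finite (descendants R r k j v)"
  by (simp add: descendants_def finite_ball)

text \<open>The ball of radius 2 around \<open>v\<close> also contains \<open>v\<close>, a parent
  and a grandparent, which exist because \<open>k \<ge> 2\<close>. They differ in depth from each
  other and from the next two levels, so 3 of the 6 places remain.\<close>

lemma card_descendants_1_2:
  assumes "k \<ge> 2" "v \<in> sphere R k r"
  shows "card (descendants R r k 1 v) + card (descendants R r k 2 v) \<le> 3"
proof -
  obtain l where k: "k = Suc (Suc l)"
    using assms(1) by (auto simp: le_iff_add)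
  obtain a where a: "a \<in> sphere R (Suc l) r" "(a, v) \<in> R"
    using assms(2) unfolding k by (rule sphere_parent)
  obtain g where g: "g \<in> sphere R l r" "(g, a) \<in> R"
    using a(1) by (rule sphere_parent)
  have sub: "{v} \<union> {a} \<union> {g} \<union> (descendants R r k 1 v \<union> descendants R r k 2 v) \<subseteq> ball R 2 v"
  proof -
    have "a \<in> ball R 1 v" using a(2) sym_R by (auto simp: ball_Suc dest: symD)
    moreover from this have "g \<in> ball R 2 v"
      using g(2) sym_R by (auto simp: numeral_2_eq_2 ball_Suc[of R "Suc 0"] dest: symD)
    ultimately show ?thesis
      using ball_mono[of 1 2 R v] self_mem_ball[of v R 2] by (auto simp: descendants_def)
  qed
  have disj: "sphere R i r \<inter> sphere R j r = {}" if "i \<noteq> j" for i j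
    using that by (rule spheres_disjoint)
  have "v \<noteq> a" "v \<noteq> g" "a \<noteq> g"
    using disj[of l "Suc l"] disj[of l k] disj[of "Suc l" k] assms(2) a(1) g(1) k by auto
  then have three: "card {v, a, g} = 3" by simp
  have depth: "v \<in> sphere R k r" "a \<in> sphere R (Suc l) r" "g \<in> sphere R l r"
    using assms(2) a(1) g(1) by auto
  have "{v, a, g} \<inter> (descendants R r k 1 v \<union> descendants R r k 2 v) = {}"
    using disj[of l "k + 1"] disj[of l "k + 2"] disj[of "Suc l" "k + 1"] disj[of "Suc l" "k + 2"]
      disj[of k "k + 1"] disj[of k "k + 2"] depth
    unfolding k descendants_def by (simp add: disjoint_iff)
  moreover have "descendants R r k 1 v \<inter> descendants R r k 2 v = {}"
    using disj[of "k + 1" "k + 2"] by (auto simp: descendants_def)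
  ultimately have "card ({v, a, g} \<union> (descendants R r k 1 v \<union> descendants R r k 2 v)) =
      3 + (card (descendants R r k 1 v) + card (descendants R r k 2 v))"
    using three finite_descendants
    by (subst card_Un_disjoint, simp, simp, blast, subst card_Un_disjoint) auto
  moreover have "card ({v, a, g} \<union> (descendants R r k 1 v \<union> descendants R r k 2 v)) \<le> 6"
    using card_mono[OF finite_ball_2 sub] card_ball_2[of v] by (simp add: insert_commute)
  ultimately show ?thesis by linarith
qed

text \<open>Two numbers with sum at most 3 cannot both exceed 1, so one of the next two levels below
  \<open>v\<close> has at most one vertex. All deeper descendants pass through this bottleneck, to
  which the induction hypothesis applies.\<close>

lemma card_descendants:
  assumes "k \<ge> 2" "v \<in> sphere R k r"
  shows "card (descendants R r k j v) \<le> 3"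
  using assms
proof (induction j arbitrary: k v rule: less_induct)
  case (less j)
  have branch: "card (descendants R r k j v) \<le> 3"
    if i: "0 < i" "i \<le> j" "card (descendants R r k i v) \<le> 1" for i
  proof -
    have "card (descendants R r k j v)
      \<le> card (\<Union>c\<in>descendants R r k i v. descendants R r (k + i) (j - i) c)"
      using descendants_add[OF less.prems(2), of i "j - i"] i
      by (intro card_mono) (auto simp: finite_descendants)
    also have "\<dots> \<le> 3"
      using i less.prems less.IH[of "j - i" "k + i"]
      by (intro card_UN_singleton_le finite_descendants) (auto simp: descendants_def)
    finally show ?thesis .
  qed
  note c12 = card_descendants_1_2[OF less.prems]
  consider "j = 0" | "j = 1" | "j \<ge> 2" "card (descendants R r k 1 v) \<le> 1"
    | "j \<ge> 2" "card (descendants R r k 2 v) \<le> 1"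
    using c12 by linarith
  then show ?case
  proof cases
    case 1
    have "card (descendants R r k 0 v) \<le> card {v}"
      by (intro card_mono) (auto simp: descendants_def)
    then show ?thesis using 1 by simp
  next
    case 2 then show ?thesis using c12 by simp
  next
    case 3 then show ?thesis by (intro branch[of 1]) auto
  next
    case 4 then show ?thesis by (intro branch[of 2]) auto
  qed
qed

text \<open>Depth 2 is the first at which the bound of 3 descendants is available; every deeper
  vertex descends from there.\<close>

lemma card_sphere: "card (sphere R k r) \<le> 18"
proof (cases "k \<ge> 2")
  case False
  then have "sphere R k r \<subseteq> ball R 2 r"
    using sphere_subset_ball[of R k r] ball_mono[of k 2 R r] by auto
  then show ?thesis using card_mono[OF finite_ball_2, of "sphere R k r" r] card_ball_2[of r] by linarith
next
  case True
  have "sphere R k r \<subseteq> descendants R r 0 (2 + (k - 2)) r"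
    using True sphere_subset_ball[of R k r] by (simp add: descendants_def del: add_2_eq_Suc)
  also have "\<dots> \<subseteq> (\<Union>c\<in>descendants R r 0 2 r. descendants R r 2 (k - 2) c)"
    using descendants_add[of r R 0 r 2 "k - 2"] by (simp only: sphere_0 singletonI add_0)
  finally have "card (sphere R k r) \<le> card (\<Union>c\<in>descendants R r 0 2 r. descendants R r 2 (k - 2) c)"
    by (intro card_mono) (auto simp: finite_descendants)
  also have "\<dots> \<le> (\<Sum>c\<in>descendants R r 0 2 r. card (descendants R r 2 (k - 2) c))"
    by (intro card_UN_le finite_descendants)
  also have "\<dots> \<le> card (descendants R r 0 2 r) * 3"
    by (intro sum_bounded_above[where K = "3::nat", simplified] card_descendants)
       (auto simp: descendants_def simp del: add_2_eq_Suc')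
  also have "card (descendants R r 0 2 r) \<le> 6"
    using card_mono[OF finite_ball_2, of "descendants R r 0 2 r" r] card_ball_2[of r]
    by (auto simp: descendants_def)
  finally show ?thesis by simp
qed

end

lemma is_root_reflcl: "is_root R E \<Longrightarrow> E\<^sup>= = R\<^sup>= ^^ 2"
  by (auto simp: is_root_def numeral_2_eq_2)

lemma is_root_ball:
  assumes "is_root R E"
  shows "ball E k r = ball R (2 * k) r"
proof (induction k)
  case (Suc k)
  have "ball E 1 v = ball R 2 v" for v
    unfolding ball_def is_root_reflcl[OF assms] by simp
  then show ?case using Suc ball_add[of E k 1 r] ball_add[of R "2 * k" 2 r] by simp
qed simp

text \<open>A ball of radius \<open>k\<close> in the square is a ball of radius \<open>2 * k\<close>
  in the root. For radius 1 this turns degree at most 5 into the bound 6 of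
  \<open>small_balls\<close>; in general it splits a sphere of the square into two spheres of the
  root.\<close>

lemma card_sphere_square:
  assumes "is_root R E" "\<And>v. finite (E `` {v})" "\<And>v. card (E `` {v}) \<le> 5"
  shows "finite (sphere E k r)" "card (sphere E k r) \<le> 36"
proof -
  have b: "ball R 2 v = insert v (E `` {v})" for v
    using is_root_ball[OF assms(1), of 1 v] by (simp add: ball_Suc numeral_2_eq_2)
  interpret small_balls R
  proof
    show "card (ball R 2 v) \<le> 6" for v
      using assms(2,3)[of v] by (simp add: b card_insert_if)
  qed (use assms in \<open>auto simp: b is_root_def\<close>)
  show "finite (sphere E k r)"
    using finite_subset[OF sphere_subset_ball[of E k r]] finite_ball is_root_ball[OF assms(1)]
    by metis
  show "card (sphere E k r) \<le> 36"
  proof (cases k)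
    case (Suc l)
    have "sphere E k r \<subseteq> sphere R (2 * l + 1) r \<union> sphere R (2 * l + 2) r"
      using is_root_ball[OF assms(1), of l] is_root_ball[OF assms(1), of "Suc l"]
      by (auto simp: Suc sphere_Suc)
    then have "card (sphere E k r) \<le> card (sphere R (2 * l + 1) r \<union> sphere R (2 * l + 2) r)"
      by (intro card_mono) (auto simp: finite_sphere)
    also have "\<dots> \<le> 18 + 18"
      using card_Un_le[of "sphere R (2 * l + 1) r" "sphere R (2 * l + 2) r"]
        card_sphere[of "2 * l + 1" r] card_sphere[of "2 * l + 2" r]
      by linarith
    finally show ?thesis by simp
  qed simp
qed

section \<open>Breadth-first search has bounded bandwidth\<close>

definition discover :: "'a list \<Rightarrow> 'a \<Rightarrow> 'a list" where
  "discover xs u = (if u \<in> set xs then xs else xs @ [u])"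

text \<open>
  In a state \<open>(xs, h, s)\<close> the list \<open>xs\<close> is the order so far, with the queue in places \<open>h\<close> and above. Each
  step advances either \<open>h\<close> or the next start candidate \<open>s\<close>, so exactly \<open>2 * n\<close> steps are needed.
\<close>

fun bfs_step :: "(nat \<Rightarrow> nat list) \<Rightarrow> nat list \<times> nat \<times> nat \<Rightarrow> nat list \<times> nat \<times> nat" where
  "bfs_step adj (xs, h, s) =
    (if h < length xs then (foldl discover xs (adj (xs ! h)), Suc h, s)
     else (discover xs s, h, Suc s))"

lemma foldl_discover:
  "\<exists>ys. foldl discover xs us = xs @ ys \<and> set ys = set us - set xs
    \<and> (distinct xs \<longrightarrow> distinct (xs @ ys))"
proof (induction us rule: rev_induct)
  case (snoc u us)
  then obtain ys where ys: "foldl discover xs us = xs @ ys" "set ys = set us - set xs"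
    "distinct xs \<longrightarrow> distinct (xs @ ys)" by blast
  show ?case
  proof (cases "u \<in> set (xs @ ys)")
    case True
    then have "foldl discover xs (us @ [u]) = xs @ ys"
      using ys(1) by (simp add: discover_def)
    moreover have "set ys = set (us @ [u]) - set xs" using True ys(2) by auto
    ultimately show ?thesis using ys(3) by blast
  next
    case False
    then have "foldl discover xs (us @ [u]) = xs @ ys @ [u]"
      using ys(1) by (simp add: discover_def)
    moreover have "set (ys @ [u]) = set (us @ [u]) - set xs" using False ys(2) by auto
    moreover have "distinct xs \<longrightarrow> distinct (xs @ ys @ [u])" using False ys(3) by auto
    ultimately show ?thesis by blast
  qed
qed simp

locale adjacency =
  fixes n :: nat and adj :: "nat \<Rightarrow> nat list" and E :: "(nat \<times> nat) set"
  assumes E_subset: "E \<subseteq> {..<n} \<times> {..<n}"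
    and sym_E: "sym E"
    and set_adj: "v < n \<Longrightarrow> set (adj v) = E `` {v}"
    and length_adj: "v < n \<Longrightarrow> length (adj v) \<le> 5"
begin

lemma finite_neighbours: "finite (E `` {v})"
  using E_subset by (auto intro: finite_subset[of _ "{..<n}"])

lemma card_neighbours: "card (E `` {v}) \<le> 5"
proof (cases "v < n")
  case True
  then show ?thesis using card_length[of "adj v"] set_adj[of v] length_adj[of v] by simp
next
  case False
  then have "E `` {v} = {}" using E_subset by auto
  then show ?thesis by simp
qed

definition bfs :: "nat \<Rightarrow> nat list \<times> nat \<times> nat" where
  "bfs k = (bfs_step adj ^^ k) ([], 0, 0)"

lemma bfs_0 [simp]: "bfs 0 = ([], 0, 0)" and bfs_Suc: "bfs (Suc k) = bfs_step adj (bfs k)"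
  by (simp_all add: bfs_def)

text \<open>The equation \<open>h + s = k\<close> measures progress: both summands are at most
  \<open>n\<close>, so after \<open>2 * n\<close> steps both equal \<open>n\<close>.\<close>

definition bfs_inv :: "nat \<Rightarrow> nat list \<times> nat \<times> nat \<Rightarrow> bool" where
  "bfs_inv k = (\<lambda>(xs, h, s). distinct xs \<and> set xs \<subseteq> {..<n} \<and> {..<s} \<subseteq> set xs
     \<and> h \<le> length xs \<and> s \<le> n \<and> h + s = k)"

lemma length_distinct_le:
  "distinct xs \<Longrightarrow> set xs \<subseteq> {..<n} \<Longrightarrow> length xs \<le> n"
  using card_mono[of "{..<n}" "set xs"] by (simp add: distinct_card)

lemma bfs_inv_length: "bfs_inv k (xs, h, s) \<Longrightarrow> length xs \<le> n"
  by (auto simp: bfs_inv_def length_distinct_le)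

lemma bfs_inv_nth: "bfs_inv k (xs, h, s) \<Longrightarrow> h < length xs \<Longrightarrow> xs ! h < n"
  using nth_mem[of h xs] unfolding bfs_inv_def by blast

text \<open>If \<open>s\<close> were \<open>n\<close>, all vertices would be discovered, and an
  empty queue would mean \<open>h = n\<close>; then all \<open>2 * n\<close> steps would already
  have been made.\<close>

lemma bfs_inv_next_start:
  assumes "bfs_inv k (xs, h, s)" "k < 2 * n" "\<not> h < length xs"
  shows "s < n"
proof (rule ccontr)
  assume "\<not> s < n"
  then have "set xs = {..<n}" "s = n" using assms by (auto simp: bfs_inv_def)
  then have "length xs = n" using assms distinct_card[of xs] by (auto simp: bfs_inv_def)
  then show False using assms \<open>s = n\<close> by (auto simp: bfs_inv_def)
qed

lemma bfs_inv: "k \<le> 2 * n \<Longrightarrow> bfs_inv k (bfs k)"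
proof (induction k)
  case (Suc k)
  obtain xs h s where b: "bfs k = (xs, h, s)" by (metis prod_cases3)
  have inv: "bfs_inv k (xs, h, s)" using Suc b by simp
  show ?case
  proof (cases "h < length xs")
    case True
    obtain ys where "foldl discover xs (adj (xs ! h)) = xs @ ys"
      "set ys = set (adj (xs ! h)) - set xs" "distinct xs \<longrightarrow> distinct (xs @ ys)"
      using foldl_discover[of xs "adj (xs ! h)"] by blast
    moreover have "xs ! h < n" using inv True by (rule bfs_inv_nth)
    then have "set (adj (xs ! h)) \<subseteq> {..<n}" using set_adj E_subset by auto
    ultimately show ?thesis
      using inv True by (auto simp: bfs_Suc b bfs_inv_def)
  next
    case False
    have "s < n" using bfs_inv_next_start[OF inv _ False] Suc.prems by simp
    then show ?thesis using inv False
      by (auto simp: bfs_Suc b bfs_inv_def discover_def less_Suc_eq)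
  qed
qed (simp add: bfs_inv_def)

definition bfs_order :: "nat list" where
  "bfs_order = fst (bfs (2 * n))"

lemma bfs_final: "bfs (2 * n) = (bfs_order, n, n)"
  and distinct_bfs_order: "distinct bfs_order"
  and set_bfs_order: "set bfs_order = {..<n}"
  and length_bfs_order: "length bfs_order = n"
proof -
  obtain xs h s where b: "bfs (2 * n) = (xs, h, s)" by (metis prod_cases3)
  have inv: "bfs_inv (2 * n) (xs, h, s)" using bfs_inv[of "2 * n"] b by simp
  then have "h = n" "s = n" "length xs = n"
    using bfs_inv_length[OF inv] by (auto simp: bfs_inv_def)
  then show "bfs (2 * n) = (bfs_order, n, n)" "distinct bfs_order" "set bfs_order = {..<n}"
    "length bfs_order = n"
    using inv b by (auto simp: bfs_order_def bfs_inv_def)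
qed

text \<open>Here \<open>r\<close> is the start vertex of the component being searched,
  \<open>d\<close> the depth of the head of the queue and \<open>m\<close> the place where the next
  layer begins.\<close>

definition layered :: "nat list \<Rightarrow> nat \<Rightarrow> bool" where
  "layered xs h \<longleftrightarrow> (\<exists>r d m. h < m \<and> m \<le> length xs \<and> ball E d r \<subseteq> set (take m xs) \<and>
     set (drop h (take m xs)) \<subseteq> sphere E d r \<and> set (drop m xs) \<subseteq> sphere E (Suc d) r)"

text \<open>Only the far side is bounded. Since \<open>E\<close> is symmetric, an arc to an earlier
  place is bounded from its other end.\<close>

definition narrow :: "nat list \<Rightarrow> nat \<Rightarrow> bool" where
  "narrow xs h \<longleftrightarrow> (\<forall>a<h. E `` {xs ! a} \<subseteq> set (take (a + 72) xs))"

lemma narrow_append: "narrow xs h \<Longrightarrow> h \<le> length xs \<Longrightarrow> narrow (xs @ ys) h"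
  unfolding narrow_def by (simp add: nth_append) blast

lemma narrow_Suc:
  "narrow xs h \<Longrightarrow> E `` {xs ! h} \<subseteq> set (take (h + 72) xs) \<Longrightarrow> narrow xs (Suc h)"
  by (auto simp: narrow_def less_Suc_eq)

text \<open>Once the neighbours of the head are appended, all places from \<open>h\<close> on belong
  to two consecutive spheres. The list has no repetitions, so at most 36 + 36 places remain, and
  every neighbour of the head stands before place \<open>h + 72\<close>.\<close>

lemma bfs_narrow:
  assumes "is_root R E" "k \<le> 2 * n" "bfs k = (xs, h, s)"
  shows "narrow xs h \<and> (h < length xs \<longrightarrow> layered xs h)"
  using assms(2,3)
proof (induction k arbitrary: xs h s)
  case (Suc k xs' h' s')
  obtain xs h s where b: "bfs k = (xs, h, s)" by (metis prod_cases3)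
  have inv: "bfs_inv k (xs, h, s)" using bfs_inv[of k] Suc.prems b by simp
  have IH: "narrow xs h" "h < length xs \<longrightarrow> layered xs h"
    using Suc.IH[OF _ b] Suc.prems by auto
  show ?case
  proof (cases "h < length xs")
    case False
    then have *: "h' = h" "xs' = discover xs s" "h = length xs"
      using Suc.prems inv by (auto simp: bfs_Suc b bfs_inv_def)
    show ?thesis
    proof (cases "s \<in> set xs")
      case True
      then show ?thesis using * IH by (simp add: discover_def)
    next
      case s: False
      have "narrow xs' h'"
        using IH(1) * s narrow_append[of xs h "[s]"] by (simp add: discover_def)
      \<comment> \<open>A new component starts: its layer 0 is \<open>s\<close> alone, at the last
        place, and the next layer is still empty.\<close>
      moreover have "layered xs' h'"
        unfolding layered_def using * s
        by (intro exI[of _ s] exI[of _ 0] exI[of _ "length xs'"]) (auto simp: discover_def)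
      ultimately show ?thesis by simp
    qed
  next
    case True
    obtain ys where ys: "foldl discover xs (adj (xs ! h)) = xs @ ys"
      "set ys = set (adj (xs ! h)) - set xs" "distinct xs \<longrightarrow> distinct (xs @ ys)"
      using foldl_discover[of xs "adj (xs ! h)"] by blast
    have eq: "xs' = xs @ ys" "h' = Suc h" using Suc.prems True ys by (auto simp: bfs_Suc b)
    have "xs ! h < n" using inv True by (rule bfs_inv_nth)
    then have set_ys: "set ys = E `` {xs ! h} - set xs" using ys set_adj by simp
    obtain r d m where m: "h < m" "m \<le> length xs" "ball E d r \<subseteq> set (take m xs)"
      "set (drop h (take m xs)) \<subseteq> sphere E d r" "set (drop m xs) \<subseteq> sphere E (Suc d) r"
      using IH True by (auto simp: layered_def)
    have h_split: "drop h xs = drop h (take m xs) @ drop m xs"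
      using m drop_append[of h "take m xs" "drop m xs"] by simp
    have "drop h (take m xs) \<noteq> []" using m by simp
    then have "hd (drop h (take m xs)) \<in> sphere E d r" using m(4) by (meson hd_in_set subsetD)
    then have "xs ! h \<in> sphere E d r" using m by (simp add: hd_drop_conv_nth)
    \<comment> \<open>A neighbour of a vertex at depth \<open>d\<close> has depth at most
      \<open>Suc d\<close>; being absent from \<open>xs\<close>, which contains the ball of radius
      \<open>d\<close>, it has depth exactly \<open>Suc d\<close>.\<close>
    then have new: "set ys \<subseteq> sphere E (Suc d) r"
      using set_ys m(3) sphere_subset_ball[of E d r] set_take_subset[of m xs]
      by (auto simp: sphere_Suc ball_Suc)
    have "distinct (drop h (xs @ ys))" using inv ys by (intro distinct_drop) (auto simp: bfs_inv_def)
    then have "length (drop h xs @ ys) = card (set (drop h xs @ ys))"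
      using True distinct_card[of "drop h xs @ ys"] by simp
    also have "\<dots> \<le> card (sphere E d r \<union> sphere E (Suc d) r)"
      using m(4,5) new h_split
      by (intro card_mono)
         (auto simp: card_sphere_square[OF assms(1) finite_neighbours card_neighbours])
    also have "\<dots> \<le> 36 + 36"
      using card_sphere_square(2)[OF assms(1) finite_neighbours card_neighbours, of d r]
        card_sphere_square(2)[OF assms(1) finite_neighbours card_neighbours, of "Suc d" r]
        card_Un_le[of "sphere E d r" "sphere E (Suc d) r"] by linarith
    finally have "length (xs @ ys) \<le> h + 72" using True by simp
    then have narrow: "narrow xs' h'"
      using narrow_append[OF IH(1), of ys] True set_ys
      unfolding eq by (intro narrow_Suc) (auto simp: nth_append)
    have "layered xs' h'" if "h' < length xs'"
    proof (cases "h' < m")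
      case True
      have "set (drop h' (take m xs')) \<subseteq> set (drop h (take m xs))"
        using m by (simp add: eq set_drop_subset_set_drop)
      then show ?thesis
        unfolding layered_def using m True new
        by (intro exI[of _ r] exI[of _ d] exI[of _ m]) (auto simp: eq)
    next
      case False
      then have h': "h' = m" using m eq by simp
      \<comment> \<open>Layer \<open>d\<close> is used up, so \<open>Suc d\<close> becomes the
        current layer and its ball must be complete. Here \<open>narrow\<close> serves a second
        purpose: it says that all neighbours of processed vertices are in the list.\<close>
      have "E `` ball E d r \<subseteq> set xs'"
      proof
        fix u assume "u \<in> E `` ball E d r"
        then obtain v where "v \<in> set (take m xs)" "(v, u) \<in> E" using m by auto
        then obtain a where a: "a < h'" "xs' ! a = v"
          using m by (auto simp: in_set_conv_nth h' eq nth_append)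
        then have "u \<in> set (take (a + 72) xs')"
          using narrow \<open>(v, u) \<in> E\<close> unfolding narrow_def by blast
        then show "u \<in> set xs'" by (rule in_set_takeD)
      qed
      then have "ball E (Suc d) r \<subseteq> set xs'"
        using m set_take_subset[of m xs] by (auto simp: ball_Suc eq)
      then show ?thesis
        unfolding layered_def using m that new h'
        by (intro exI[of _ r] exI[of _ "Suc d"] exI[of _ "length xs'"]) (auto simp: eq)
    qed
    then show ?thesis using narrow by simp
  qed
qed (simp add: narrow_def)

lemma bandwidth_bfs_order:
  assumes "is_root R E" "a < n" "b < n" "(bfs_order ! a, bfs_order ! b) \<in> E"
  shows "b < a + 72"
proof -
  have "bfs_order ! b \<in> set (take (a + 72) bfs_order)"
    using bfs_narrow[OF assms(1) _ bfs_final] assms by (auto simp: narrow_def)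
  then obtain c where "c < a + 72" "c < n" "bfs_order ! c = bfs_order ! b"
    by (auto simp: in_set_conv_nth length_bfs_order)
  then show ?thesis
    using distinct_bfs_order assms(3) by (simp add: nth_eq_iff_index_eq length_bfs_order)
qed

end

section \<open>Local certificates for roots\<close>

text \<open>
  In the label of vertex \<open>i\<close>, offset \<open>p\<close> stands for vertex \<open>i + p - b\<close>; the two components are the
  neighbourhoods of \<open>i\<close> in the square and in the root. In \<open>local_root\<close>, all offsets are shifted by
  \<open>b\<close> so that the end of a two-step walk with offsets \<open>p\<close> and \<open>q\<close> is \<open>p + q\<close>, even if it lies outside
  the window.
\<close>

type_synonym label = "nat set \<times> nat set"

definition local_root :: "nat \<Rightarrow> (nat \<Rightarrow> label option) \<Rightarrow> bool" where
  "local_root b f \<longleftrightarrow> (\<forall>N h. f b = Some (N, h) \<longrightarrow>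
     h \<subseteq> {1..<2 * b} - {b} \<and>
     (\<forall>p\<in>h. \<exists>M g. f p = Some (M, g) \<and> 2 * b - p \<in> g) \<and>
     (+) b ` N = (+) b ` h \<union> {p + q | p q. p \<in> h \<and> (\<exists>M g. f p = Some (M, g) \<and> q \<in> g)} - {2 * b})"

text \<open>This justifies a finite memory: the offsets in \<open>h\<close> are confined to the
  window, and labels are looked up only at such offsets, so \<open>2 * b - 1\<close> labels
  determine the condition.\<close>

lemma local_root_cong:
  assumes "0 < b" "\<And>p. 1 \<le> p \<Longrightarrow> p < 2 * b \<Longrightarrow> f p = g p"
  shows "local_root b f = local_root b g"
proof -
  have *: "f p = g p" if "p \<in> h" "h \<subseteq> {1..<2 * b} - {b}" for p h
    using that by (intro assms(2)) auto
  have sets: "{p + q | p q. p \<in> h \<and> (\<exists>M G. f p = Some (M, G) \<and> q \<in> G)} =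
      {p + q | p q. p \<in> h \<and> (\<exists>M G. g p = Some (M, G) \<and> q \<in> G)}"
    if "h \<subseteq> {1..<2 * b} - {b}" for h
    using *[OF _ that] by (intro Collect_cong) (metis (no_types, lifting))
  have "f b = g b" using assms by auto
  then show ?thesis
    unfolding local_root_def
    by (intro all_cong1 imp_cong conj_cong ball_cong) (auto simp: * sets)
qed

definition window :: "nat \<Rightarrow> nat \<Rightarrow> (nat \<Rightarrow> label) \<Rightarrow> nat \<Rightarrow> nat \<Rightarrow> label option" where
  "window b n y i p = (if b \<le> i + p \<and> i + p < n + b then Some (y (i + p - b)) else None)"

text \<open>The equation stands for \<open>p = j + b - i\<close> without truncation: an arc leading
  back by more than \<open>b\<close> places has no offset at all.\<close>

definition offsets :: "nat \<Rightarrow> (nat \<times> nat) set \<Rightarrow> nat \<Rightarrow> nat set" where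
  "offsets b R i = {p. \<exists>j. (i, j) \<in> R \<and> i + p = j + b}"

definition from_offsets :: "nat \<Rightarrow> nat \<Rightarrow> (nat \<Rightarrow> nat set) \<Rightarrow> (nat \<times> nat) set" where
  "from_offsets b n h = {(i, j). i < n \<and> j < n \<and> (\<exists>p\<in>h i. i + p = j + b)}"

lemma window_offset:
  assumes "j < n" "i + p = j + b"
  shows "window b n y i p = Some (y j)"
  using assms by (simp add: window_def)

lemma window_SomeE:
  assumes "window b n y i p = Some l"
  obtains j where "j < n" "i + p = j + b" "l = y j"
  using assms that[of "i + p - b"] by (auto simp: window_def split: if_splits)

text \<open>The clauses of \<open>local_root\<close> are those of \<open>is_root\<close>, restricted
  to arcs that leave \<open>i\<close>. The length bounds ensure that all offsets involved are
  natural numbers, so the translation loses nothing.\<close>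

lemma local_root_window:
  assumes "i < n" and E: "\<And>i j. (i, j) \<in> E \<Longrightarrow> j < n \<and> i < j + b"
    and R: "R \<subseteq> {..<n} \<times> {..<n}" "\<And>i j. (i, j) \<in> R \<Longrightarrow> i < j + b \<and> j < i + b"
  shows "local_root b (window b n (\<lambda>i. (offsets b E i, offsets b R i)) i) \<longleftrightarrow>
    (i, i) \<notin> R \<and> (\<forall>j. (i, j) \<in> R \<longrightarrow> (j, i) \<in> R) \<and> E `` {i} = (R\<^sup>= O R\<^sup>= - Id) `` {i}"
proof -
  let ?w = "window b n (\<lambda>i. (offsets b E i, offsets b R i)) i"
  have b: "?w b = Some (offsets b E i, offsets b R i)"
    using assms(1) by (intro window_offset) auto
  have mem: "p \<in> offsets b S i \<longleftrightarrow> (i, j) \<in> S" if "i + p = j + b" for p j i and S :: "(nat \<times> nat) set"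
    using that by (auto simp: offsets_def)
  have 1: "offsets b R i \<subseteq> {1..<2 * b} - {b} \<longleftrightarrow> (i, i) \<notin> R"
    using R(2)[of i] by (fastforce simp: offsets_def)
  \<comment> \<open>If \<open>p\<close> is the offset of \<open>j\<close> seen from
    \<open>i\<close>, then \<open>2 * b - p\<close> is the offset of \<open>i\<close> seen from
    \<open>j\<close>.\<close>
  have 2: "(\<forall>p\<in>offsets b R i. \<exists>M g. ?w p = Some (M, g) \<and> 2 * b - p \<in> g) \<longleftrightarrow>
    (\<forall>j. (i, j) \<in> R \<longrightarrow> (j, i) \<in> R)"
  proof -
    have "(\<exists>M g. ?w p = Some (M, g) \<and> 2 * b - p \<in> g) \<longleftrightarrow> (j, i) \<in> R"
      if "(i, j) \<in> R" "i + p = j + b" for p j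
    proof -
      have "j < n" using that R by auto
      moreover have "j + (2 * b - p) = i + b" using R(2)[OF that(1)] that(2) by simp
      ultimately show ?thesis using that mem[of j "2 * b - p" i R] by (simp add: window_offset)
    qed
    moreover have "\<exists>p. i + p = j + b" if "(i, j) \<in> R" for j
      using R(2)[OF that] by (intro exI[of _ "j + b - i"]) simp
    ultimately show ?thesis unfolding offsets_def by blast
  qed
  have 3: "{p + q | p q. p \<in> offsets b R i \<and> (\<exists>M g. ?w p = Some (M, g) \<and> q \<in> g)} =
    {p + q | p q. \<exists>l j. (i, l) \<in> R \<and> (l, j) \<in> R \<and> i + p = l + b \<and> l + q = j + b}"
  proof -
    have "p \<in> offsets b R i \<and> (\<exists>M g. ?w p = Some (M, g) \<and> q \<in> g) \<longleftrightarrow>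
        (\<exists>l j. (i, l) \<in> R \<and> (l, j) \<in> R \<and> i + p = l + b \<and> l + q = j + b)" for p q
    proof
      assume "p \<in> offsets b R i \<and> (\<exists>M g. ?w p = Some (M, g) \<and> q \<in> g)"
      then obtain l where l: "(i, l) \<in> R" "i + p = l + b" "\<exists>M g. ?w p = Some (M, g) \<and> q \<in> g"
        by (auto simp: offsets_def)
      moreover have "l < n" using l R by auto
      ultimately show "\<exists>l j. (i, l) \<in> R \<and> (l, j) \<in> R \<and> i + p = l + b \<and> l + q = j + b"
        by (auto simp: window_offset offsets_def)
    next
      assume "\<exists>l j. (i, l) \<in> R \<and> (l, j) \<in> R \<and> i + p = l + b \<and> l + q = j + b"
      then obtain l j where l: "(i, l) \<in> R" "(l, j) \<in> R" "i + p = l + b" "l + q = j + b" by blast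
      moreover have "l < n" using l R by auto
      ultimately show "p \<in> offsets b R i \<and> (\<exists>M g. ?w p = Some (M, g) \<and> q \<in> g)"
        by (auto simp: window_offset offsets_def)
    qed
    then show ?thesis by simp
  qed
  \<comment> \<open>A vertex \<open>j\<close> is coded as \<open>j + 2 * b - i\<close>. The shift is
    \<open>2 * b\<close> because two steps may lead back almost that far; \<open>i\<close> itself
    gets the code \<open>2 * b\<close>, whose removal subtracts the identity.\<close>
  let ?sh = "\<lambda>J. {s. \<exists>j\<in>J. i + s = j + 2 * b}"
  have shift: "(+) b ` offsets b S i = ?sh (S `` {i})" if "\<And>j. (i, j) \<in> S \<Longrightarrow> i < j + b"
    for S :: "(nat \<times> nat) set"
  proof (intro set_eqI iffI)
    fix s assume "s \<in> ?sh (S `` {i})"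
    then obtain j where "(i, j) \<in> S" "i + s = j + 2 * b" by auto
    then show "s \<in> (+) b ` offsets b S i"
      using that[of j] by (intro image_eqI[of _ _ "s - b"]) (auto simp: offsets_def)
  qed (auto simp: offsets_def)
  have inj: "?sh J = ?sh K \<longleftrightarrow> J = K"
    if "\<And>j. j \<in> J \<union> K \<Longrightarrow> i < j + 2 * b" for J K
  proof
    assume eq: "?sh J = ?sh K"
    have "j \<in> J \<longleftrightarrow> j + 2 * b - i \<in> ?sh J" "j \<in> K \<longleftrightarrow> j + 2 * b - i \<in> ?sh K"
      if "j \<in> J \<union> K" for j
      using \<open>\<And>j. j \<in> J \<union> K \<Longrightarrow> i < j + 2 * b\<close>[OF that] by auto
    then show "J = K" using eq by blast
  qed simp
  have "{p + q | p q. \<exists>l j. (i, l) \<in> R \<and> (l, j) \<in> R \<and> i + p = l + b \<and> l + q = j + b} =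
      ?sh ((R O R) `` {i})"
  proof (intro set_eqI iffI)
    fix s assume "s \<in> ?sh ((R O R) `` {i})"
    then obtain l j where "(i, l) \<in> R" "(l, j) \<in> R" "i + s = j + 2 * b" by auto
    then show "s \<in> {p + q | p q. \<exists>l j. (i, l) \<in> R \<and> (l, j) \<in> R \<and> i + p = l + b \<and> l + q = j + b}"
      using R(2)[of i l] R(2)[of l j]
      by (intro CollectI exI[of _ "l + b - i"] exI[of _ "j + b - l"] conjI exI[of _ l] exI[of _ j]) auto
  next
    fix s assume "s \<in> {p + q | p q. \<exists>l j. (i, l) \<in> R \<and> (l, j) \<in> R \<and> i + p = l + b \<and> l + q = j + b}"
    then obtain p q l j where "s = p + q" "(i, l) \<in> R" "(l, j) \<in> R" "i + p = l + b" "l + q = j + b"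
      by blast
    then show "s \<in> ?sh ((R O R) `` {i})"
      by (intro CollectI bexI[of _ j]) auto
  qed
  moreover have "?sh J \<union> ?sh K - {2 * b} = ?sh ((J \<union> K) - {i})" for J K by auto
  ultimately have 4: "(+) b ` offsets b E i = (+) b ` offsets b R i \<union>
      {p + q | p q. p \<in> offsets b R i \<and> (\<exists>M g. ?w p = Some (M, g) \<and> q \<in> g)} - {2 * b} \<longleftrightarrow>
      ?sh (E `` {i}) = ?sh (R `` {i} \<union> (R O R) `` {i} - {i})"
    using shift[of E] shift[of R] E R(2) unfolding 3 by presburger
  also have "\<dots> \<longleftrightarrow> E `` {i} = R `` {i} \<union> (R O R) `` {i} - {i}"
  proof (rule inj)
    fix j assume "j \<in> E `` {i} \<union> (R `` {i} \<union> (R O R) `` {i} - {i})"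
    then consider "(i, j) \<in> E" | "(i, j) \<in> R" | l where "(i, l) \<in> R" "(l, j) \<in> R" by auto
    then show "i < j + 2 * b"
    proof cases
      case 3 then show ?thesis using R(2)[of i l] R(2)[of l j] by simp
    qed (use E[of i j] R(2)[of i j] in auto)
  qed
  also have "R `` {i} \<union> (R O R) `` {i} - {i} = (R\<^sup>= O R\<^sup>= - Id) `` {i}" by auto
  finally show ?thesis
    unfolding local_root_def b using 1 2 by simp
qed

text \<open>A root confined to arcs shorter than \<open>b\<close> amounts to one guessed offset set
  per vertex, and being a root becomes a condition checked at each vertex separately.\<close>

lemma is_root_iff_local_root:
  assumes E: "E \<subseteq> {..<n} \<times> {..<n}" "\<And>i j. (i, j) \<in> E \<Longrightarrow> i < j + b \<and> j < i + b"
  shows "(\<exists>R. is_root R E) \<longleftrightarrow>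
    (\<exists>h. (\<forall>i<n. h i \<subseteq> {1..<2 * b}) \<and> (\<forall>i<n. local_root b (window b n (\<lambda>i. (offsets b E i, h i)) i)))"
    (is "_ \<longleftrightarrow> ?rhs")
proof
  assume "\<exists>R. is_root R E"
  then obtain R where R: "is_root R E" by blast
  have sub: "R \<subseteq> E" by (rule is_root_subset[OF R])
  have "local_root b (window b n (\<lambda>i. (offsets b E i, offsets b R i)) i)" if "i < n" for i
  proof -
    have "(i, i) \<notin> R" "\<forall>j. (i, j) \<in> R \<longrightarrow> (j, i) \<in> R" "E = R\<^sup>= O R\<^sup>= - Id"
      using R by (auto simp: is_root_def irrefl_def dest: symD)
    moreover have "R \<subseteq> {..<n} \<times> {..<n}" "\<And>i j. (i, j) \<in> R \<Longrightarrow> i < j + b \<and> j < i + b"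
      "\<And>i j. (i, j) \<in> E \<Longrightarrow> j < n \<and> i < j + b"
      using E sub by blast+
    ultimately show ?thesis using local_root_window[OF that, of E b R] by blast
  qed
  moreover have "offsets b R i \<subseteq> {1..<2 * b}" for i
    using sub E(2)[of i] by (fastforce simp: offsets_def)
  ultimately show ?rhs by blast
next
  assume ?rhs
  then obtain h where h: "\<And>i. i < n \<Longrightarrow> h i \<subseteq> {1..<2 * b}"
    "\<And>i. i < n \<Longrightarrow> local_root b (window b n (\<lambda>i. (offsets b E i, h i)) i)" by blast
  define R where "R = from_offsets b n h"
  have R: "R \<subseteq> {..<n} \<times> {..<n}" "\<And>i j. (i, j) \<in> R \<Longrightarrow> i < j + b \<and> j < i + b"
    using h(1) by (fastforce simp: R_def from_offsets_def)+
  \<comment> \<open>An offset in \<open>h i\<close> might point outside the graph and get lost in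
    \<open>from_offsets\<close>. The symmetry clause of \<open>local_root\<close> excludes this,
    since it demands a label at that offset.\<close>
  have off: "offsets b R i = h i" if i: "i < n" for i
  proof (intro set_eqI iffI)
    fix p assume p: "p \<in> h i"
    have "window b n (\<lambda>i. (offsets b E i, h i)) i b = Some (offsets b E i, h i)"
      using i by (intro window_offset) auto
    then have "\<forall>p\<in>h i. \<exists>M g. window b n (\<lambda>i. (offsets b E i, h i)) i p = Some (M, g) \<and> 2 * b - p \<in> g"
      using h(2)[OF i] by (simp add: local_root_def)
    then obtain l where "window b n (\<lambda>i. (offsets b E i, h i)) i p = Some l" using p by blast
    then obtain j where "j < n" "i + p = j + b" by (rule window_SomeE)
    then show "p \<in> offsets b R i" using p i by (auto simp: offsets_def R_def from_offsets_def)
  next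
    fix p assume "p \<in> offsets b R i"
    then obtain j q where "q \<in> h i" "i + p = j + b" "i + q = j + b"
      by (auto simp: offsets_def R_def from_offsets_def)
    then show "p \<in> h i" by (metis add_left_imp_eq)
  qed
  have "window b n (\<lambda>i. (offsets b E i, offsets b R i)) = window b n (\<lambda>i. (offsets b E i, h i))"
    by (auto simp: window_def off fun_eq_iff)
  then have *: "(i, i) \<notin> R \<and> (\<forall>j. (i, j) \<in> R \<longrightarrow> (j, i) \<in> R) \<and> E `` {i} = (R\<^sup>= O R\<^sup>= - Id) `` {i}"
    if "i < n" for i
    using h(2)[OF that] E R by (subst local_root_window[OF that, symmetric]) auto
  have "is_root R E"
    unfolding is_root_def
  proof (intro conjI)
    show "sym R" using * R(1) by (auto intro!: symI)
    show "irrefl R" using * R(1) by (auto simp: irrefl_def)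
    show "E = R\<^sup>= O R\<^sup>= - Id"
    proof (intro set_eqI)
      fix x :: "nat \<times> nat"
      obtain i j where x: "x = (i, j)" by fastforce
      show "x \<in> E \<longleftrightarrow> x \<in> R\<^sup>= O R\<^sup>= - Id"
      proof (cases "i < n")
        case True
        then have "j \<in> E `` {i} \<longleftrightarrow> j \<in> (R\<^sup>= O R\<^sup>= - Id) `` {i}" using * by simp
        then show ?thesis using x by simp
      next
        case False
        then show ?thesis using x E(1) R(1) by auto
      qed
    qed
  qed
  then show "\<exists>R. is_root R E" by blast
qed

section \<open>Subset construction on sliding windows of labels\<close>

definition compatible :: "nat \<Rightarrow> nat set option \<Rightarrow> label option \<Rightarrow> bool" where
  "compatible b x a \<longleftrightarrow> (case x of None \<Rightarrow> a = None
     | Some N \<Rightarrow> N \<subseteq> {1..<2 * b} \<and> (\<exists>h\<subseteq>{1..<2 * b}. a = Some (N, h)))"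

definition local_root_word :: "nat \<Rightarrow> label option list \<Rightarrow> bool" where
  "local_root_word b w \<longleftrightarrow> local_root b (\<lambda>p. w ! (p - 1))"

text \<open>The window moves by one place, with every admissible guess for the new label. The
  condition is tested at the middle letter, which was appended \<open>b - 1\<close> moves earlier,
  when its whole surroundings are visible.\<close>

definition extend :: "nat \<Rightarrow> nat set option \<Rightarrow> label option list set \<Rightarrow> label option list set" where
  "extend b x S = {tl w @ [a] | w a. w \<in> S \<and> compatible b x a \<and> local_root_word b (tl w @ [a])}"

text \<open>The padding plays two parts: it is the window before the first vertex, and as a suffix
  of the input it pushes the last vertices through the middle.\<close>

definition pad :: "nat \<Rightarrow> 'a option list" where
  "pad b = replicate (2 * b - 1) None"

definition labelling_from :: "nat \<Rightarrow> nat \<Rightarrow> label option list \<Rightarrow> label option list" where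
  "labelling_from b t y = take (2 * b - 1) (drop t (pad b @ y))"

text \<open>Correctness of the subset construction: a state consists of the current windows of all
  guesses \<open>y\<close> that have passed every test so far. Appending a letter leaves the earlier
  windows unchanged.\<close>

lemma foldl_extend:
  assumes "0 < b"
  shows "foldl (\<lambda>S x. extend b x S) {pad b} xs =
    {labelling_from b (length y) y | y. list_all2 (compatible b) xs y \<and>
      (\<forall>t<length y. local_root_word b (labelling_from b (Suc t) y))}"
    (is "_ = ?reach xs")
proof (induction xs rule: rev_induct)
  case Nil
  show ?case by (auto simp: labelling_from_def pad_def)
next
  case (snoc x xs)
  have last: "labelling_from b (Suc (length y)) (y @ [a]) = tl (labelling_from b (length y) y) @ [a]"
    for y a
  proof -
    define z :: "label option list" where "z = pad b @ y"
    have z: "length z = 2 * b - 1 + length y" by (simp add: z_def pad_def)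
    have "drop (Suc (length y)) (z @ [a]) = tl (drop (length y) z) @ [a]"
      using z assms by (simp add: drop_Suc tl_drop)
    moreover have "take (2 * b - 1) (tl (drop (length y) z) @ [a]) = tl (drop (length y) z) @ [a]"
      "take (2 * b - 1) (drop (length y) z) = drop (length y) z"
      using z assms by simp_all
    ultimately show ?thesis by (simp add: labelling_from_def z_def)
  qed
  have old: "labelling_from b (Suc t) (y @ [a]) = labelling_from b (Suc t) y" if "t < length y" for t y a
    using that by (simp add: labelling_from_def pad_def)
  have "extend b x (?reach xs) = ?reach (xs @ [x])"
  proof (intro set_eqI iffI)
    fix w assume "w \<in> extend b x (?reach xs)"
    then obtain y a where "w = tl (labelling_from b (length y) y) @ [a]"
      "list_all2 (compatible b) xs y" "\<forall>t<length y. local_root_word b (labelling_from b (Suc t) y)"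
      "compatible b x a" "local_root_word b w"
      unfolding extend_def by blast
    then show "w \<in> ?reach (xs @ [x])"
      by (intro CollectI exI[of _ "y @ [a]"])
        (auto simp: last old less_Suc_eq intro: list_all2_appendI)
  next
    fix w assume "w \<in> ?reach (xs @ [x])"
    then obtain y' where y': "w = labelling_from b (length y') y'"
      "list_all2 (compatible b) (xs @ [x]) y'"
      "\<forall>t<length y'. local_root_word b (labelling_from b (Suc t) y')" by blast
    then obtain y a where "y' = y @ [a]" "list_all2 (compatible b) xs y" "compatible b x a"
      by (auto simp: list_all2_append1 list_all2_Cons1)
    then show "w \<in> extend b x (?reach xs)"
      using y' unfolding extend_def by (auto simp: last old less_Suc_eq)
  qed
  then show ?case using snoc by simp
qed

lemma nth_labelling_from:
  assumes "1 \<le> p" "p < 2 * b" "t \<le> length y"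
  shows "labelling_from b t y ! (p - 1) = (if t + p < 2 * b then None else y ! (t + p - 2 * b))"
proof -
  have "labelling_from b t y ! (p - 1) = (pad b @ y) ! (t + (p - 1))"
    unfolding labelling_from_def using assms
    by (subst nth_take, simp, subst nth_drop) (auto simp: pad_def)
  then show ?thesis using assms by (auto simp: pad_def nth_append)
qed

lemma nth_padded:
  assumes "m < n + (2 * b - 1)"
  shows "(map (\<lambda>i. Some (l i)) [0..<n] @ pad b) ! m = (if m < n then Some (l m) else None)"
  using assms by (auto simp: nth_append pad_def)

text \<open>Vertex \<open>i\<close> contributes letter number \<open>i + 1\<close>, and
  \<open>b - 1\<close> further letters bring it to the middle.\<close>

lemma labelling_window:
  assumes "0 < b" "i < n" "y = map (\<lambda>i. Some (l i)) [0..<n] @ pad b"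
  shows "local_root_word b (labelling_from b (i + b) y) \<longleftrightarrow> local_root b (window b n l i)"
  unfolding local_root_word_def
proof (rule local_root_cong[OF assms(1)])
  fix p assume "1 \<le> p" "p < 2 * b"
  then show "labelling_from b (i + b) y ! (p - 1) = window b n l i p"
    using assms(2) nth_labelling_from[of p b "i + b" y] nth_padded[of "i + b + p - 2 * b" n b l]
    by (auto simp: window_def pad_def assms(3))
qed

lemma labelling_centre_None:
  assumes "0 < b" "t < n + (2 * b - 1)" "y = map (\<lambda>i. Some (l i)) [0..<n] @ pad b"
    "Suc t < b \<or> n + b \<le> Suc t"
  shows "local_root_word b (labelling_from b (Suc t) y)"
proof -
  have "labelling_from b (Suc t) y ! (b - 1) = None"
    using assms nth_labelling_from[of b b "Suc t" y] nth_padded[of "Suc t + b - 2 * b" n b l]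
    by (auto simp: pad_def)
  then show ?thesis by (simp add: local_root_word_def local_root_def)
qed

lemma list_all2_compatible_iff:
  "list_all2 (compatible b) (map (\<lambda>i. Some (N i)) [0..<n] @ pad b') y \<longleftrightarrow>
    (\<forall>i<n. N i \<subseteq> {1..<2 * b}) \<and>
    (\<exists>h. (\<forall>i<n. h i \<subseteq> {1..<2 * b}) \<and> y = map (\<lambda>i. Some (N i, h i)) [0..<n] @ pad b')"
    (is "?L \<longleftrightarrow> ?N \<and> ?R")
proof
  assume ?L
  then obtain u v where y: "y = u @ v" "length u = n"
    and u: "list_all2 (compatible b) (map (\<lambda>i. Some (N i)) [0..<n]) u"
    and v: "list_all2 (compatible b) (pad b') v"
    by (auto simp: list_all2_append1 dest: list_all2_lengthD)
  have "v = pad b'"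
    using v by (auto simp: list_all2_conv_all_nth pad_def compatible_def intro!: nth_equalityI)
  have "\<forall>i<n. N i \<subseteq> {1..<2 * b} \<and> (\<exists>h\<subseteq>{1..<2 * b}. u ! i = Some (N i, h))"
    using u by (auto simp: list_all2_conv_all_nth compatible_def)
  then obtain h where h: "\<forall>i<n. N i \<subseteq> {1..<2 * b} \<and> h i \<subseteq> {1..<2 * b} \<and> u ! i = Some (N i, h i)"
    by metis
  then have "u = map (\<lambda>i. Some (N i, h i)) [0..<n]" using y(2) by (auto intro!: nth_equalityI)
  then show "?N \<and> ?R" using h y \<open>v = pad b'\<close> by blast
next
  assume "?N \<and> ?R"
  then obtain h where N: ?N and h: "\<forall>i<n. h i \<subseteq> {1..<2 * b}"
    and y: "y = map (\<lambda>i. Some (N i, h i)) [0..<n] @ pad b'" by blast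
  have "list_all2 (compatible b) (map (\<lambda>i. Some (N i)) [0..<n]) (map (\<lambda>i. Some (N i, h i)) [0..<n])"
    using N h by (simp add: list_all2_conv_all_nth compatible_def)
  moreover have "list_all2 (compatible b) (pad b') (pad b')"
    by (simp add: list_all2_conv_all_nth pad_def compatible_def)
  ultimately show ?L unfolding y by (rule list_all2_appendI)
qed

text \<open>Each vertex is tested exactly once, in the window after \<open>i + b\<close> letters;
  every other window has \<open>None\<close> in the middle and passes vacuously.\<close>

lemma foldl_extend_nonempty:
  assumes "0 < b"
  shows "foldl (\<lambda>S x. extend b x S) {pad b} (map (\<lambda>i. Some (N i)) [0..<n] @ pad b) \<noteq> {} \<longleftrightarrow>
    (\<forall>i<n. N i \<subseteq> {1..<2 * b}) \<and> (\<exists>h. (\<forall>i<n. h i \<subseteq> {1..<2 * b}) \<and>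
      (\<forall>i<n. local_root b (window b n (\<lambda>i. (N i, h i)) i)))"
proof -
  have "(\<forall>t<length y. local_root_word b (labelling_from b (Suc t) y)) \<longleftrightarrow>
      (\<forall>i<n. local_root b (window b n l i))"
    if "y = map (\<lambda>i. Some (l i)) [0..<n] @ pad b" for l y
  proof -
    have len: "length y = n + (2 * b - 1)" using that by (simp add: pad_def)
    have "local_root b (window b n l i) \<longleftrightarrow> local_root_word b (labelling_from b (Suc (i + b - 1)) y)"
      if "i < n" for i
      using labelling_window[OF assms that \<open>y = _\<close>] assms by simp
    moreover have "i + b - 1 < length y" if "i < n" for i using that len assms by simp
    moreover have "local_root_word b (labelling_from b (Suc t) y) \<or> (\<exists>i<n. t = i + b - 1)"
      if "t < length y" for t
    proof (cases "Suc t < b \<or> n + b \<le> Suc t")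
      case True
      moreover have "t < n + (2 * b - 1)" using that unfolding len .
      ultimately show ?thesis using labelling_centre_None[OF assms _ \<open>y = _\<close>] by blast
    next
      case False
      then show ?thesis using assms by (intro disjI2 exI[of _ "Suc t - b"]) auto
    qed
    ultimately show ?thesis by metis
  qed
  note windows = this[OF refl]
  let ?y = "\<lambda>h. map (\<lambda>i. Some (N i, h i)) [0..<n] @ pad b"
  let ?ok = "\<lambda>y. \<forall>t<length y. local_root_word b (labelling_from b (Suc t) y)"
  have "foldl (\<lambda>S x. extend b x S) {pad b} (map (\<lambda>i. Some (N i)) [0..<n] @ pad b) \<noteq> {} \<longleftrightarrow>
      (\<exists>y. list_all2 (compatible b) (map (\<lambda>i. Some (N i)) [0..<n] @ pad b) y \<and> ?ok y)"
    unfolding foldl_extend[OF assms] by simp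
  also have "\<dots> \<longleftrightarrow> (\<forall>i<n. N i \<subseteq> {1..<2 * b}) \<and>
      (\<exists>h. (\<forall>i<n. h i \<subseteq> {1..<2 * b}) \<and> ?ok (?y h))"
  proof -
    have "(\<exists>y. (A \<and> (\<exists>h. H h \<and> y = Y h)) \<and> W y) \<longleftrightarrow> A \<and> (\<exists>h. H h \<and> W (Y h))"
      for A and H :: "(nat \<Rightarrow> nat set) \<Rightarrow> bool" and Y :: "_ \<Rightarrow> label option list" and W by auto
    from this[of "\<forall>i<n. N i \<subseteq> {1..<2 * b}" "\<lambda>h. \<forall>i<n. h i \<subseteq> {1..<2 * b}" ?y ?ok]
    show ?thesis unfolding list_all2_compatible_iff .
  qed
  finally show ?thesis unfolding windows .
qed

definition recognises_roots :: "nat \<Rightarrow> (nat \<Rightarrow> nat set) \<Rightarrow> nat \<Rightarrow> bool" where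
  "recognises_roots b N n \<longleftrightarrow>
    foldl (\<lambda>S x. extend b x S) {pad b} (map (\<lambda>i. Some (N i)) [0..<n] @ pad b) \<noteq> {}"

text \<open>
  The reported offset \<open>j + b - i\<close> is truncated at 0 and cut off at \<open>2 * b\<close>; both of these
  values lie outside \<open>{1..<2 * b}\<close>, so an arc that is too long for the window leaves no label.
\<close>

lemma recognises_roots_iff:
  assumes "0 < b" "E \<subseteq> {..<n} \<times> {..<n}" "sym E"
    and "\<And>R i j. is_root R E \<Longrightarrow> (i, j) \<in> E \<Longrightarrow> j < i + b"
  shows "recognises_roots b (\<lambda>i. (\<lambda>j. min (j + b - i) (2 * b)) ` E `` {i}) n \<longleftrightarrow> (\<exists>R. is_root R E)"
proof -
  let ?N = "\<lambda>i. (\<lambda>j. min (j + b - i) (2 * b)) ` E `` {i}"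
  have "(\<forall>i<n. ?N i \<subseteq> {1..<2 * b}) \<longleftrightarrow> (\<forall>(i, j)\<in>E. min (j + b - i) (2 * b) \<in> {1..<2 * b})"
    using assms(2) unfolding image_subset_iff by blast
  also have "\<dots> \<longleftrightarrow> (\<forall>(i, j)\<in>E. i < j + b \<and> j < i + b)"
    using assms(1) by (intro ball_cong) auto
  finally have narrow: "(\<forall>i<n. ?N i \<subseteq> {1..<2 * b}) \<longleftrightarrow> (\<forall>(i, j)\<in>E. i < j + b \<and> j < i + b)" .
  show ?thesis
  proof (cases "\<forall>(i, j)\<in>E. i < j + b \<and> j < i + b")
    case True
    have "?N i = offsets b E i" for i
    proof (intro set_eqI iffI)
      fix p assume "p \<in> ?N i"
      then obtain j where j: "(i, j) \<in> E" "p = min (j + b - i) (2 * b)" by auto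
      then have "i < j + b" "j < i + b" using True by auto
      then show "p \<in> offsets b E i" using j by (auto simp: offsets_def)
    next
      fix p assume "p \<in> offsets b E i"
      then obtain j where j: "(i, j) \<in> E" "i + p = j + b" by (auto simp: offsets_def)
      then have "j < i + b" using True by auto
      then show "p \<in> ?N i" using j by (intro image_eqI[of _ _ j]) auto
    qed
    then show ?thesis
      unfolding recognises_roots_def foldl_extend_nonempty[OF assms(1)] using narrow True
      by (subst is_root_iff_local_root[OF assms(2), of b]) auto
  next
    \<comment> \<open>Both sides are false: by symmetry some arc is too long in the forward
      direction, contrary to the bound that a root would give, and the automaton dies on an offset
      outside the window.\<close>
    case False
    then have "\<not> (\<exists>R. is_root R E)" using assms(3,4) by (fast dest: symD)
    then show ?thesis
      unfolding recognises_roots_def foldl_extend_nonempty[OF assms(1)] narrow using False by blast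
  qed
qed

text \<open>Being a root is invariant under renaming vertices; this moves between the graph and its
  copy on places of the search order. Injectivity matters where a composition identifies two middle
  vertices.\<close>

lemma is_root_image:
  assumes "is_root R E" "inj_on f A" "E \<subseteq> A \<times> A"
  shows "is_root (map_prod f f ` R) (map_prod f f ` E)"
proof -
  have R: "R \<subseteq> A \<times> A" using is_root_subset[OF assms(1)] assms(3) by blast
  have inj: "f x = f y \<longleftrightarrow> x = y" if "x \<in> A" "y \<in> A" for x y
    using assms(2) that by (auto simp: inj_on_def)
  have "sym R" "irrefl R" "E = R\<^sup>= O R\<^sup>= - Id" using assms(1) by (auto simp: is_root_def)
  moreover have "sym (map_prod f f ` R)" using \<open>sym R\<close> by (force intro!: symI dest: symD)
  moreover have "irrefl (map_prod f f ` R)"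
    using \<open>irrefl R\<close> R inj by (fastforce simp: irrefl_def)
  moreover have "map_prod f f ` R O map_prod f f ` R = map_prod f f ` (R O R)"
  proof (intro set_eqI iffI)
    fix z assume "z \<in> map_prod f f ` R O map_prod f f ` R"
    then obtain u v v' w where z: "z = (f u, f w)" "(u, v) \<in> R" "(v', w) \<in> R" "f v = f v'" by auto
    moreover have "v = v'" using z R inj by blast
    ultimately show "z \<in> map_prod f f ` (R O R)" by force
  qed force
  moreover have E: "E = (R \<union> R O R) - Id" using \<open>E = _\<close> \<open>irrefl R\<close> by auto
  moreover have "map_prod f f ` ((R \<union> R O R) - Id) = map_prod f f ` (R \<union> R O R) - Id"
    using R inj by (auto simp: image_iff)
  ultimately show ?thesis by (auto simp: is_root_def)
qed

section \<open>Finiteness and numbering of the automaton states\<close>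

definition label_words :: "nat \<Rightarrow> label option list set" where
  "label_words b = {w. set w \<subseteq> insert None (Some ` (Pow {1..<2 * b} \<times> Pow {1..<2 * b})) \<and> length w = 2 * b - 1}"

lemma finite_label_words: "finite (label_words b)"
  unfolding label_words_def by (intro finite_lists_length_eq) auto

lemma pad_in_label_words: "pad b \<in> label_words b"
  by (auto simp: label_words_def pad_def set_replicate_conv_if)

lemma extend_subset:
  assumes "0 < b" "S \<subseteq> label_words b"
  shows "extend b (Some N) S \<subseteq> label_words b"
proof
  fix w' assume "w' \<in> extend b (Some N) S"
  then obtain w h where w: "w' = tl w @ [Some (N, h)]" "w \<in> S" "N \<subseteq> {1..<2 * b}" "h \<subseteq> {1..<2 * b}"
    unfolding extend_def compatible_def by auto
  have "w \<in> label_words b" using w(2) assms(2) by blast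
  then have "set w \<subseteq> insert None (Some ` (Pow {1..<2 * b} \<times> Pow {1..<2 * b}))" "length w = 2 * b - 1"
    by (auto simp: label_words_def)
  moreover have "set (tl w) \<subseteq> set w" by (cases w) auto
  ultimately show "w' \<in> label_words b"
    using w(1,3,4) assms(1) unfolding label_words_def by (auto simp: image_iff)
qed

text \<open>
  The states \<open>q < K\<close> encode sets of label words, paired with the offsets read since the last vertex
  was closed; \<open>f\<close> reads an offset, \<open>g\<close> closes a vertex and \<open>a\<close> gives the verdict.
\<close>

definition root_automaton ::
  "nat \<Rightarrow> nat \<Rightarrow> nat \<Rightarrow> (nat \<Rightarrow> nat \<Rightarrow> nat) \<Rightarrow> (nat \<Rightarrow> nat) \<Rightarrow> (nat \<Rightarrow> nat) \<Rightarrow> bool" where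
  "root_automaton b K q0 f g a \<longleftrightarrow> q0 < K \<and> (\<forall>q e. q < K \<longrightarrow> e \<le> 2 * b \<longrightarrow> f q e < K) \<and>
    (\<forall>q<K. g q < K) \<and> (\<forall>q. a q \<le> 1) \<and>
    (\<forall>n M. (\<forall>i<n. set (M i) \<subseteq> {..2 * b}) \<longrightarrow>
      a (foldl (\<lambda>q i. g (foldl f q (M i))) q0 [0..<n]) =
        (if recognises_roots b (\<lambda>i. set (M i)) n then 1 else 0))"

text \<open>The number of states depends on \<open>b\<close> only, so the transition functions can
  become fixed program text.\<close>

lemma ex_root_automaton:
  assumes b: "0 < b"
  shows "\<exists>K q0 f g a. root_automaton b K q0 f g a"
proof -
  \<comment> \<open>The second component ranges up to \<open>2 * b\<close> and includes 0, so that
    the codes of overlong arcs can be recorded before the closing of the vertex rejects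
    them.\<close>
  let ?Q = "Pow (label_words b) \<times> Pow {..2 * b}"
  have fin: "finite ?Q" by (simp add: finite_label_words)
  then obtain enc where enc: "bij_betw enc ?Q {0..<card ?Q}"
    using ex_bij_betw_finite_nat by blast
  define K where "K = card ?Q"
  define dec where "dec = inv_into ?Q enc"
  have dec_enc: "dec (enc s) = s" if "s \<in> ?Q" for s
    using enc that unfolding dec_def by (metis bij_betw_inv_into_left)
  have dec: "dec q \<in> ?Q" if "q < K" for q
    using bij_betw_inv_into[OF enc] that unfolding dec_def K_def by (auto dest: bij_betwE)
  have enc_less: "enc s < K" if "s \<in> ?Q" for s
    using enc that unfolding K_def by (auto dest!: bij_betwE)
  define f where "f q e = enc (fst (dec q), insert e (snd (dec q)))" for q e
  define g where "g q = enc (extend b (Some (snd (dec q))) (fst (dec q)), {})" for q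
  \<comment> \<open>Reading the final padding is absorbed into the verdict, so states reached inside
    the padding need no numbers.\<close>
  define a where "a q = (if foldl (\<lambda>S x. extend b x S) (fst (dec q)) (pad b) \<noteq> {} then 1 else 0 :: nat)" for q
  define q0 where "q0 = enc ({pad b}, {})"
  have start: "({pad b}, {}) \<in> ?Q" using pad_in_label_words by simp
  have f_mem: "(S, insert e N) \<in> ?Q" if "(S, N) \<in> ?Q" "e \<le> 2 * b" for S N e
    using that by auto
  have g_mem: "(extend b (Some N) S, {}) \<in> ?Q" if "(S, N) \<in> ?Q" for S N
    using that extend_subset[OF b] by auto
  have fold_f: "foldl f (enc (S, N)) es = enc (S, N \<union> set es) \<and> (S, N \<union> set es) \<in> ?Q"
    if "(S, N) \<in> ?Q" "set es \<subseteq> {..2 * b}" for S N es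
    using that
  proof (induction es arbitrary: N)
    case (Cons e es)
    have "f (enc (S, N)) e = enc (S, insert e N)"
      unfolding f_def using dec_enc[OF Cons.prems(1)] by simp
    moreover have "(S, insert e N) \<in> ?Q" using f_mem[OF Cons.prems(1), of e] Cons.prems(2) by simp
    ultimately show ?case using Cons.IH[of "insert e N"] Cons.prems(2) by simp
  qed simp
  have fold_g: "foldl (\<lambda>q i. g (foldl f q (M i))) q0 [0..<n] =
      enc (foldl (\<lambda>S x. extend b x S) {pad b} (map (\<lambda>i. Some (set (M i))) [0..<n]), {}) \<and>
      (foldl (\<lambda>S x. extend b x S) {pad b} (map (\<lambda>i. Some (set (M i))) [0..<n]), {}) \<in> ?Q"
    if "\<And>i. i < n \<Longrightarrow> set (M i) \<subseteq> {..2 * b}" for n and M :: "nat \<Rightarrow> nat list"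
    using that
  proof (induction n)
    case 0
    then show ?case using start by (simp add: q0_def)
  next
    case (Suc n)
    define S where "S = foldl (\<lambda>S x. extend b x S) {pad b} (map (\<lambda>i. Some (set (M i))) [0..<n])"
    have IH: "foldl (\<lambda>q i. g (foldl f q (M i))) q0 [0..<n] = enc (S, {})" "(S, {}) \<in> ?Q"
      using Suc.IH Suc.prems unfolding S_def by auto
    have "foldl f (enc (S, {})) (M n) = enc (S, set (M n))" "(S, set (M n)) \<in> ?Q"
      using fold_f[OF IH(2), of "M n"] Suc.prems[of n] by auto
    moreover have "g (enc (S, set (M n))) = enc (extend b (Some (set (M n))) S, {})"
      unfolding g_def using dec_enc[OF \<open>(S, set (M n)) \<in> ?Q\<close>] by simp
    ultimately show ?case
      using IH(1) g_mem[of S "set (M n)"] by (simp add: S_def)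
  qed
  have "root_automaton b K q0 f g a"
    unfolding root_automaton_def
  proof (intro conjI allI impI)
    show "q0 < K" unfolding q0_def using start by (rule enc_less)
    show "f q e < K" if "q < K" "e \<le> 2 * b" for q e
      unfolding f_def using dec[OF that(1)] that(2) by (intro enc_less f_mem) auto
    show "g q < K" if "q < K" for q
      unfolding g_def using dec[OF that] by (intro enc_less g_mem) auto
    show "a q \<le> 1" for q by (simp add: a_def)
    show "a (foldl (\<lambda>q i. g (foldl f q (M i))) q0 [0..<n]) =
        (if recognises_roots b (\<lambda>i. set (M i)) n then 1 else 0)"
      if "\<forall>i<n. set (M i) \<subseteq> {..2 * b}" for n and M :: "nat \<Rightarrow> nat list"
      using fold_g[of n M] that by (simp add: a_def dec_enc recognises_roots_def del: foldl_map)
  qed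
  then show ?thesis by blast
qed

context adjacency
begin

text \<open>The automaton sees \<open>E'\<close>, the copy of \<open>E\<close> on places, which has
  a root exactly when \<open>E\<close> has one.\<close>

lemma recognises_roots_bfs_order:
  assumes rank: "\<And>i. i < n \<Longrightarrow> rank (bfs_order ! i) = i"
  shows "recognises_roots 72
      (\<lambda>i. set (map (\<lambda>u. min (rank u + 72 - i) (2 * 72)) (adj (bfs_order ! i)))) n \<longleftrightarrow>
    (\<exists>R. is_root R E)"
proof -
  define E' where "E' = {(i, j). i < n \<and> j < n \<and> (bfs_order ! i, bfs_order ! j) \<in> E}"
  have nth: "bfs_order ! i < n" if "i < n" for i
    using that nth_mem[of i bfs_order] by (simp add: set_bfs_order length_bfs_order)
  have ex_nth: "\<exists>i<n. bfs_order ! i = u" if "u < n" for u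
    using that set_bfs_order by (metis in_set_conv_nth length_bfs_order lessThan_iff)
  have inj: "inj_on ((!) bfs_order) {..<n}"
    using rank by (metis inj_onI lessThan_iff)
  have inj_rank: "inj_on rank {..<n}"
    using rank ex_nth by (metis inj_onI lessThan_iff)
  have image_E': "map_prod ((!) bfs_order) ((!) bfs_order) ` E' = E"
  proof (intro set_eqI iffI)
    fix z assume z: "z \<in> E"
    obtain u v where uv: "z = (u, v)" by fastforce
    then have "u < n" "v < n" using z E_subset by auto
    then obtain i j where "i < n" "bfs_order ! i = u" "j < n" "bfs_order ! j = v" using ex_nth by metis
    then have "(i, j) \<in> E'" using z uv by (simp add: E'_def)
    then show "z \<in> map_prod ((!) bfs_order) ((!) bfs_order) ` E'"
      using uv \<open>bfs_order ! i = u\<close> \<open>bfs_order ! j = v\<close> by force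
  qed (auto simp: E'_def)
  have image_E: "map_prod rank rank ` E = E'"
    unfolding image_E'[symmetric] image_image
    by (force simp: E'_def rank)
  have sub: "E' \<subseteq> {..<n} \<times> {..<n}" by (auto simp: E'_def)
  have roots: "(\<exists>R. is_root R E') \<longleftrightarrow> (\<exists>R. is_root R E)"
    using is_root_image[OF _ inj sub] is_root_image[OF _ inj_rank E_subset]
    unfolding image_E' image_E by blast
  have N: "set (map (\<lambda>u. min (rank u + 72 - i) (2 * 72)) (adj (bfs_order ! i))) =
      (\<lambda>j. min (j + 72 - i) (2 * 72)) ` E' `` {i}" if "i < n" for i
  proof -
    have "rank ` E `` {bfs_order ! i} = E' `` {i}"
    proof (intro set_eqI iffI)
      fix j assume "j \<in> rank ` E `` {bfs_order ! i}"
      then obtain u where u: "(bfs_order ! i, u) \<in> E" "j = rank u" by auto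
      then have "u < n" using E_subset by auto
      then obtain k where "k < n" "bfs_order ! k = u" using ex_nth by blast
      then show "j \<in> E' `` {i}" using u that rank by (auto simp: E'_def)
    next
      fix j assume "j \<in> E' `` {i}"
      then show "j \<in> rank ` E `` {bfs_order ! i}" using rank by (force simp: E'_def)
    qed
    then have "(\<lambda>j. min (j + 72 - i) (2 * 72)) ` rank ` E `` {bfs_order ! i} =
      (\<lambda>j. min (j + 72 - i) (2 * 72)) ` E' `` {i}" by (rule arg_cong)
    then show ?thesis by (simp only: set_map set_adj[OF nth[OF that]] image_image)
  qed
  have "recognises_roots 72
      (\<lambda>i. set (map (\<lambda>u. min (rank u + 72 - i) (2 * 72)) (adj (bfs_order ! i)))) n \<longleftrightarrow>
    recognises_roots 72 (\<lambda>i. (\<lambda>j. min (j + 72 - i) (2 * 72)) ` E' `` {i}) n"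
    unfolding recognises_roots_def by (intro arg_cong[where f = "\<lambda>xs. foldl _ _ (xs @ _) \<noteq> {}"] map_cong)
      (use N in auto)
  also have "\<dots> \<longleftrightarrow> (\<exists>R. is_root R E')"
  proof (rule recognises_roots_iff)
    show "sym E'" using sym_E by (auto simp: E'_def intro!: symI dest: symD)
    \<comment> \<open>A root of the copy gives one of \<open>E\<close>, and that is what bounds the
      bandwidth of the order.\<close>
    fix R i j assume "is_root R E'" "(i, j) \<in> E'"
    then have "\<exists>R. is_root R E" using roots by blast
    then show "j < i + 72"
      using \<open>(i, j) \<in> E'\<close> bandwidth_bfs_order[of _ i j] by (auto simp: E'_def)
  qed (use sub in auto)
  finally show ?thesis using roots by simp
qed

end

section \<open>Structured programs\<close>

datatype com =
    Nop
  | Ins instr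
  | Seq com com (infixr ";;" 60)
  | Cond nat com com
  | Loop nat com

fun code_length :: "com \<Rightarrow> nat" where
  "code_length Nop = 0"
| "code_length (Ins i) = 1"
| "code_length (c ;; d) = code_length c + code_length d"
| "code_length (Cond r c d) = code_length c + code_length d + 2"
| "code_length (Loop r c) = code_length c + 2"

text \<open>The argument \<open>l\<close> is the address of the first instruction; it is needed
  because jump targets are absolute.\<close>

fun compile :: "nat \<Rightarrow> com \<Rightarrow> program" where
  "compile l Nop = []"
| "compile l (Ins i) = [i]"
| "compile l (c ;; d) = compile l c @ compile (l + code_length c) d"
| "compile l (Cond r c d) =
    JumpIfZero r (l + code_length c + 2) # compile (l + 1) c @
    Jump (l + code_length c + code_length d + 2) # compile (l + code_length c + 2) d"
| "compile l (Loop r c) =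
    JumpIfZero r (l + code_length c + 2) # compile (l + 1) c @ [Jump l]"

lemma length_compile [simp]: "length (compile l c) = code_length c"
  by (induction c arbitrary: l) auto

fun straight :: "instr \<Rightarrow> bool" where
  "straight (Jump _) = False"
| "straight (JumpIfZero _ _) = False"
| "straight _ = True"

text \<open>Only constants and sums can exceed all values already present; copying, loading and
  storing move values, and truncated subtraction does not increase them. So this is all that the
  word size has to be checked against.\<close>

fun fresh_value :: "instr \<Rightarrow> config \<Rightarrow> nat" where
  "fresh_value (Const r k) s = k"
| "fresh_value (Add r t u) s = regs s t + regs s u"
| "fresh_value _ s = 0"

text \<open>
  The semantics of structured commands has no program counter; its states reuse the field
  \<open>pc\<close> as a clock.
\<close>

definition tick :: "config \<Rightarrow> config" where
  "tick s = s\<lparr>pc := Suc (pc s)\<rparr>"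

text \<open>The ticks mirror the compiled jumps: the nonzero branch of \<open>Cond\<close> pays for
  the test and the jump over the other branch, the zero branch for the test alone; a loop round pays
  for the test and the jump back.\<close>

inductive exec :: "nat \<Rightarrow> com \<Rightarrow> config \<Rightarrow> config \<Rightarrow> bool" for w where
  Nop: "exec w Nop s s"
| Ins: "straight i \<Longrightarrow> fresh_value i s < 2 ^ w \<Longrightarrow> exec w (Ins i) s (exec_instr i s)"
| Seq: "exec w c s s' \<Longrightarrow> exec w d s' s'' \<Longrightarrow> exec w (c ;; d) s s''"
| CondTrue: "regs s r \<noteq> 0 \<Longrightarrow> exec w c (tick s) s' \<Longrightarrow> exec w (Cond r c d) s (tick s')"
| CondFalse: "regs s r = 0 \<Longrightarrow> exec w d (tick s) s' \<Longrightarrow> exec w (Cond r c d) s s'"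
| LoopFalse: "regs s r = 0 \<Longrightarrow> exec w (Loop r c) s (tick s)"
| LoopTrue: "regs s r \<noteq> 0 \<Longrightarrow> exec w c (tick s) s' \<Longrightarrow> exec w (Loop r c) (tick s') s'' \<Longrightarrow>
    exec w (Loop r c) s s''"

inductive_cases exec_elims:
  "exec w Nop s s'" "exec w (Ins i) s s'" "exec w (c ;; d) s s'" "exec w (Cond r c d) s s'"

definition runs :: "program \<Rightarrow> nat \<Rightarrow> nat \<Rightarrow> config \<Rightarrow> config \<Rightarrow> bool" where
  "runs P w k s s' \<longleftrightarrow> (step P ^^ k) s = s' \<and> (\<forall>j\<le>k. fits_word_size w ((step P ^^ j) s))"

lemma runs_trans:
  assumes "runs P w k s s'" "runs P w l s' s''"
  shows "runs P w (k + l) s s''"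
proof -
  have add: "(step P ^^ (k + j)) s = (step P ^^ j) s'" for j
    using assms(1) by (simp add: runs_def funpow_add add.commute[of k])
  have "fits_word_size w ((step P ^^ j) s)" if "j \<le> k + l" for j
  proof (cases "j \<le> k")
    case False
    then have "(step P ^^ j) s = (step P ^^ (j - k)) s'" using add[of "j - k"] by simp
    then show ?thesis using assms(2) that by (simp add: runs_def)
  qed (use assms in \<open>simp add: runs_def\<close>)
  then show ?thesis using assms(2) add[of l] by (simp add: runs_def)
qed

lemma runs_0: "fits_word_size w s \<Longrightarrow> runs P w 0 s s"
  by (simp add: runs_def)

lemma runs_instr:
  assumes "P = pre @ i # post" "pc s = length pre"
    and "fits_word_size w s" "fits_word_size w (exec_instr i s)"
  shows "runs P w 1 s (exec_instr i s)"
proof -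
  have "step P s = exec_instr i s"
    using assms(1,2) by (simp add: step_def halted_def nth_append)
  then show ?thesis using assms(3,4) by (auto simp: runs_def le_Suc_eq)
qed

lemma fits_pc [simp]: "fits_word_size w (s\<lparr>pc := l\<rparr>) = fits_word_size w s"
  by (simp add: fits_word_size_def)

lemma fits_tick [simp]: "fits_word_size w (tick s) = fits_word_size w s"
  by (simp add: tick_def)

lemma fits_exec_instr:
  "straight i \<Longrightarrow> fresh_value i s < 2 ^ w \<Longrightarrow> fits_word_size w s \<Longrightarrow> fits_word_size w (exec_instr i s)"
  by (cases i) (auto simp: fits_word_size_def intro: le_less_trans[OF diff_le_self])

lemma exec_instr_straight:
  "straight i \<Longrightarrow> exec_instr i (s\<lparr>pc := l\<rparr>) = (exec_instr i s)\<lparr>pc := Suc l\<rparr>"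
  "straight i \<Longrightarrow> pc (exec_instr i s) = Suc (pc s)"
  by (cases i; simp)+

text \<open>Arbitrary surrounding code \<open>pre\<close> and \<open>post\<close> makes the
  induction work for nested commands. The advance of the clock is exactly the number
  \<open>k\<close> of machine steps.\<close>

lemma exec_runs:
  assumes "exec w c s s'" "fits_word_size w s" "P = pre @ compile (length pre) c @ post"
  shows "\<exists>k. pc s' = pc s + k \<and> fits_word_size w s' \<and>
    runs P w k (s\<lparr>pc := length pre\<rparr>) (s'\<lparr>pc := length pre + code_length c\<rparr>)"
  using assms
proof (induction arbitrary: pre post rule: exec.induct)
  case (Nop s)
  then show ?case by (auto intro!: exI[of _ 0] runs_0)
next
  case (Ins i s)
  have "runs P w 1 (s\<lparr>pc := length pre\<rparr>) (exec_instr i (s\<lparr>pc := length pre\<rparr>))"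
    using Ins by (intro runs_instr) (auto simp: exec_instr_straight fits_exec_instr)
  then show ?case using Ins by (auto simp: exec_instr_straight fits_exec_instr intro!: exI[of _ 1])
next
  case (Seq c s s' d s'')
  obtain k where k: "pc s' = pc s + k" "fits_word_size w s'"
    "runs P w k (s\<lparr>pc := length pre\<rparr>) (s'\<lparr>pc := length pre + code_length c\<rparr>)"
    using Seq.IH(1)[of pre "compile (length pre + code_length c) d @ post"] Seq.prems by auto
  moreover obtain l where "pc s'' = pc s' + l" "fits_word_size w s''"
    "runs P w l (s'\<lparr>pc := length pre + code_length c\<rparr>)
      (s''\<lparr>pc := length pre + code_length c + code_length d\<rparr>)"
    using Seq.IH(2)[of "pre @ compile (length pre) c" post] Seq.prems k by auto
  ultimately show ?case by (auto simp: add.assoc intro!: exI[of _ "k + l"] intro: runs_trans)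
next
  case (CondTrue s r c s' d)
  let ?a = "length pre" and ?b = "length pre + code_length c + 1"
  let ?e = "length pre + code_length c + code_length d + 2"
  have "runs P w 1 (s\<lparr>pc := ?a\<rparr>) (exec_instr (JumpIfZero r (?a + code_length c + 2)) (s\<lparr>pc := ?a\<rparr>))"
    using CondTrue.prems by (intro runs_instr) auto
  then have 1: "runs P w 1 (s\<lparr>pc := ?a\<rparr>) ((tick s)\<lparr>pc := ?a + 1\<rparr>)"
    using CondTrue.hyps by (simp add: tick_def)
  obtain k where k: "pc s' = pc (tick s) + k" "fits_word_size w s'"
    "runs P w k ((tick s)\<lparr>pc := ?a + 1\<rparr>) (s'\<lparr>pc := ?b\<rparr>)"
    using CondTrue.IH[of "pre @ [JumpIfZero r (?a + code_length c + 2)]"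
      "Jump ?e # compile (?a + code_length c + 2) d @ post"] CondTrue.prems by auto
  have e: "runs P w 1 (s'\<lparr>pc := ?b\<rparr>) (exec_instr (Jump ?e) (s'\<lparr>pc := ?b\<rparr>))"
    using CondTrue.prems k(2)
    by (intro runs_instr[where pre = "pre @ JumpIfZero r (?a + code_length c + 2) # compile (?a + 1) c"]) auto
  have "runs P w (1 + k + 1) (s\<lparr>pc := ?a\<rparr>) ((tick s')\<lparr>pc := ?e\<rparr>)"
    using runs_trans[OF runs_trans[OF 1 k(3)] e] by (simp add: tick_def)
  then show ?case using k by (auto simp: tick_def add.assoc intro!: exI[of _ "1 + k + 1"])
next
  case (CondFalse s r d s' c)
  let ?a = "length pre" and ?b = "length pre + code_length c + 2"
  let ?e = "length pre + code_length c + code_length d + 2"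
  have "runs P w 1 (s\<lparr>pc := ?a\<rparr>) (exec_instr (JumpIfZero r ?b) (s\<lparr>pc := ?a\<rparr>))"
    using CondFalse.prems by (intro runs_instr) auto
  then have 1: "runs P w 1 (s\<lparr>pc := ?a\<rparr>) ((tick s)\<lparr>pc := ?b\<rparr>)"
    using CondFalse.hyps by (simp add: tick_def)
  obtain k where k: "pc s' = pc (tick s) + k" "fits_word_size w s'"
    "runs P w k ((tick s)\<lparr>pc := ?b\<rparr>) (s'\<lparr>pc := ?e\<rparr>)"
    using CondFalse.IH[of "pre @ JumpIfZero r ?b # compile (?a + 1) c @ [Jump ?e]" post]
      CondFalse.prems by (auto simp: algebra_simps)
  then show ?case using runs_trans[OF 1 k(3)]
    by (auto simp: tick_def add.assoc intro!: exI[of _ "1 + k"])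
next
  case (LoopFalse s r c)
  let ?a = "length pre"
  have "runs P w 1 (s\<lparr>pc := ?a\<rparr>) (exec_instr (JumpIfZero r (?a + code_length c + 2)) (s\<lparr>pc := ?a\<rparr>))"
    using LoopFalse.prems by (intro runs_instr) auto
  then show ?case using LoopFalse by (auto simp: tick_def add.assoc intro!: exI[of _ 1])
next
  case (LoopTrue s r c s' s'')
  let ?a = "length pre" and ?b = "length pre + code_length c + 1"
  let ?i = "JumpIfZero r (?a + code_length c + 2)"
  have "runs P w 1 (s\<lparr>pc := ?a\<rparr>) (exec_instr ?i (s\<lparr>pc := ?a\<rparr>))"
    using LoopTrue.prems by (intro runs_instr) auto
  then have 1: "runs P w 1 (s\<lparr>pc := ?a\<rparr>) ((tick s)\<lparr>pc := ?a + 1\<rparr>)"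
    using LoopTrue.hyps by (simp add: tick_def)
  obtain k where k: "pc s' = pc (tick s) + k" "fits_word_size w s'"
    "runs P w k ((tick s)\<lparr>pc := ?a + 1\<rparr>) (s'\<lparr>pc := ?b\<rparr>)"
    using LoopTrue.IH(1)[of "pre @ [?i]" "Jump ?a # post"] LoopTrue.prems by auto
  have e: "runs P w 1 (s'\<lparr>pc := ?b\<rparr>) (exec_instr (Jump ?a) (s'\<lparr>pc := ?b\<rparr>))"
    using LoopTrue.prems k(2)
    by (intro runs_instr[where pre = "pre @ ?i # compile (?a + 1) c"]) auto
  have 2: "runs P w (1 + k + 1) (s\<lparr>pc := ?a\<rparr>) ((tick s')\<lparr>pc := ?a\<rparr>)"
    using runs_trans[OF runs_trans[OF 1 k(3)] e] by (simp add: tick_def)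
  obtain l where l: "pc s'' = pc (tick s') + l" "fits_word_size w s''"
    "runs P w l ((tick s')\<lparr>pc := ?a\<rparr>) (s''\<lparr>pc := ?a + code_length (Loop r c)\<rparr>)"
    using LoopTrue.IH(2)[of pre post] LoopTrue.prems k(2) by auto
  show ?case using runs_trans[OF 2 l(3)] k(1) l(1,2)
    by (auto simp: tick_def intro!: exI[of _ "1 + k + 1 + l"])
qed

section \<open>Weakest preconditions for total correctness\<close>

definition wp :: "nat \<Rightarrow> com \<Rightarrow> (config \<Rightarrow> bool) \<Rightarrow> config \<Rightarrow> bool" where
  "wp w c Q s \<longleftrightarrow> (\<exists>s'. exec w c s s' \<and> Q s')"

lemma wp_mono: "wp w c Q s \<Longrightarrow> (\<And>s'. Q s' \<Longrightarrow> Q' s') \<Longrightarrow> wp w c Q' s"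
  by (auto simp: wp_def)

lemma wp_Nop [simp]: "wp w Nop Q s = Q s"
  by (auto simp: wp_def intro: exec.intros elim: exec_elims)

lemma wp_Ins [simp]: "straight i \<Longrightarrow> wp w (Ins i) Q s = (fresh_value i s < 2 ^ w \<and> Q (exec_instr i s))"
  by (auto simp: wp_def intro: exec.intros elim: exec_elims)

lemma wp_Seq [simp]: "wp w (c ;; d) Q = wp w c (wp w d Q)"
  by (fastforce simp: wp_def fun_eq_iff intro: exec.intros elim: exec_elims)

lemma wp_Cond [simp]:
  "wp w (Cond r c d) Q s =
    (if regs s r \<noteq> 0 then wp w c (\<lambda>s'. Q (tick s')) (tick s) else wp w d Q (tick s))"
  by (cases "regs s r = 0")
     (auto simp: wp_def intro: exec.CondTrue exec.CondFalse elim!: exec_elims(4))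

text \<open>All loops here run a number of rounds known in advance, so an invariant indexed by the
  round replaces a termination measure.\<close>

lemma wp_Loop_count:
  assumes "I 0 s"
    and "\<And>i s. i < N \<Longrightarrow> I i s \<Longrightarrow> regs s r \<noteq> 0 \<and> wp w c (\<lambda>s'. I (Suc i) (tick s')) (tick s)"
    and "\<And>s. I N s \<Longrightarrow> regs s r = 0 \<and> Q (tick s)"
  shows "wp w (Loop r c) Q s"
proof -
  have "wp w (Loop r c) Q s" if "i \<le> N" "I i s" for i s
    using that
  proof (induction arbitrary: s rule: inc_induct)
    case base
    then show ?case using assms(3) by (auto simp: wp_def intro: exec.LoopFalse)
  next
    case (step i)
    obtain s' where s': "exec w c (tick s) s'" "I (Suc i) (tick s')"
      using assms(2)[OF step.hyps(2) step.prems] by (auto simp: wp_def)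
    then obtain s'' where "exec w (Loop r c) (tick s') s''" "Q s''"
      using step.IH by (auto simp: wp_def)
    then show ?case
      using assms(2)[OF step.hyps(2) step.prems] s' by (auto simp: wp_def intro: exec.LoopTrue)
  qed
  then show ?thesis using assms(1) by blast
qed

section \<open>Lookup in hard-wired tables\<close>

definition yields :: "config \<Rightarrow> nat \<Rightarrow> nat set \<Rightarrow> nat \<Rightarrow> config \<Rightarrow> bool" where
  "yields s v A b s' \<longleftrightarrow> regs s' 0 = v \<and> mem s' = mem s \<and>
    (\<forall>r. r \<notin> A \<longrightarrow> regs s' r = regs s r) \<and> pc s' \<le> pc s + b"

text \<open>Without computed jumps, a case distinction counts the register down to 0. The last
  branch catches all larger values.\<close>

fun switch :: "nat \<Rightarrow> com list \<Rightarrow> com" where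
  "switch r [] = Nop"
| "switch r [c] = c"
| "switch r (c # d # cs) = Cond r (Ins (Sub r r 1) ;; switch r (d # cs)) c"

text \<open>Each skipped branch costs three ticks: test, decrement, final jump. The branches are
  assumed correct from any state that differs in \<open>r\<close>, because \<open>r\<close> has been
  counted down when they start.\<close>

lemma wp_switch:
  assumes "regs s 1 = 1" "r \<noteq> 1" "r \<in> A" "cs \<noteq> []"
    and "\<And>i t. i < length cs \<Longrightarrow> mem t = mem s \<Longrightarrow> (\<And>x. x \<noteq> r \<Longrightarrow> regs t x = regs s x) \<Longrightarrow>
      wp w (cs ! i) (yields t (v i) A b) t"
  shows "wp w (switch r cs) (yields s (v (min (regs s r) (length cs - 1))) A (b + 3 * length cs)) s"
  using assms
proof (induction r cs arbitrary: s v rule: switch.induct)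
  case (2 r c)
  have "wp w c (yields s (v 0) A b) s" using 2(5)[of 0 s] by simp
  then have "wp w c (yields s (v 0) A (b + 3)) s" by (rule wp_mono) (auto simp: yields_def)
  then show ?case by simp
next
  case (3 r c d cs)
  show ?case
  proof (cases "regs s r = 0")
    case True
    have "wp w c (yields (tick s) (v 0) A b) (tick s)" using 3(6)[of 0 "tick s"] by (simp add: tick_def)
    then have "wp w c (yields s (v 0) A (b + 3 * length (c # d # cs))) (tick s)"
      by (rule wp_mono) (auto simp: yields_def tick_def)
    then show ?thesis using True by simp
  next
    case False
    let ?t = "exec_instr (Sub r r 1) (tick s)"
    have "wp w (switch r (d # cs))
      (yields ?t (v (Suc (min (regs ?t r) (length (d # cs) - 1)))) A (b + 3 * length (d # cs))) ?t"
    proof (rule "3.IH")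
      fix i and t :: config assume i: "i < length (d # cs)" "mem t = mem ?t"
        "\<And>x. x \<noteq> r \<Longrightarrow> regs t x = regs ?t x"
      then show "wp w ((d # cs) ! i) (yields t (v (Suc i)) A b) t"
        using 3(6)[of "Suc i" t] by (simp add: tick_def)
    qed (use 3 in \<open>auto simp: tick_def\<close>)
    moreover have "Suc (min (regs ?t r) (length (d # cs) - 1)) = min (regs s r) (length (c # d # cs) - 1)"
      using False 3(2,3) by (auto simp: tick_def)
    ultimately have "wp w (switch r (d # cs))
      (yields ?t (v (min (regs s r) (length (c # d # cs) - 1))) A (b + 3 * length (d # cs))) ?t"
      by simp
    then have "wp w (switch r (d # cs)) (\<lambda>s'. yields s (v (min (regs s r) (length (c # d # cs) - 1))) A
        (b + 3 * length (c # d # cs)) (tick s')) ?t"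
      by (rule wp_mono) (use 3(4) in \<open>auto simp: yields_def tick_def\<close>)
    then show ?thesis using False by simp
  qed
qed simp

definition table :: "nat \<Rightarrow> (nat \<Rightarrow> nat) \<Rightarrow> com" where
  "table K f = switch 0 (map (\<lambda>k. Ins (Const 0 (f k))) [0..<K])"

lemma wp_table:
  assumes "regs s 1 = 1" "regs s 0 < K" "\<And>k. k < K \<Longrightarrow> f k < 2 ^ w" "0 \<in> A"
  shows "wp w (table K f) (yields s (f (regs s 0)) A (1 + 3 * K)) s"
proof -
  have "wp w (table K f) (yields s (f (min (regs s 0) (K - 1))) A (1 + 3 * K)) s"
    using wp_switch[of s 0 A "map (\<lambda>k. Ins (Const 0 (f k))) [0..<K]" w f 1] assms
    unfolding table_def by (auto simp: yields_def)
  then show ?thesis using assms(2) by simp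
qed

definition table2 :: "nat \<Rightarrow> nat \<Rightarrow> nat \<Rightarrow> (nat \<Rightarrow> nat \<Rightarrow> nat) \<Rightarrow> com" where
  "table2 r K L f = switch r (map (\<lambda>e. table K (\<lambda>q. f q e)) [0..<Suc L])"

text \<open>The cut-off of the offset at \<open>L\<close> comes for free from the last branch of
  \<open>switch\<close>.\<close>

lemma wp_table2:
  assumes "regs s 1 = 1" "r > 1" "regs s 0 < K" "\<And>k e. k < K \<Longrightarrow> e \<le> L \<Longrightarrow> f k e < 2 ^ w"
  shows "wp w (table2 r K L f)
    (yields s (f (regs s 0) (min (regs s r) L)) {0, r} (1 + 3 * K + 3 * Suc L)) s"
proof -
  have "wp w (map (\<lambda>e. table K (\<lambda>q. f q e)) [0..<Suc L] ! i)
      (yields t (f (regs s 0) i) {0, r} (1 + 3 * K)) t"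
    if "i < length (map (\<lambda>e. table K (\<lambda>q. f q e)) [0..<Suc L])"
      "\<And>x. x \<noteq> r \<Longrightarrow> regs t x = regs s x" for i t
    using wp_table[of t K "\<lambda>q. f q i" w "{0, r}"] assms that by (simp del: upt_Suc)
  then have "wp w (table2 r K L f)
    (yields s (f (regs s 0) (min (regs s r) (length (map (\<lambda>e. table K (\<lambda>q. f q e)) [0..<Suc L]) - 1)))
      {0, r} (1 + 3 * K + 3 * length (map (\<lambda>e. table K (\<lambda>q. f q e)) [0..<Suc L]))) s"
    unfolding table2_def using assms by (intro wp_switch) (auto simp del: upt_Suc)
  then show ?thesis by simp
qed

section \<open>The breadth-first search program\<close>

text \<open>
  Register 1 holds 1, register 2 holds \<open>n\<close>, and registers 3, 4, 5 hold the base addresses of three arrays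
  behind the input: the address of each adjacency list, the breadth-first order, and for each vertex
  its position in that order plus 1 (0 if undiscovered). Registers 6, 7, 8 are the head and the tail of
  the queue and the next candidate for a start vertex, 9 and 11 are loop counters, 10 points into the
  input, 0 is the state of the automaton, and the others are scratch.
\<close>

definition setup_code :: com where
  "setup_code =
    Ins (Const 1 1) ;; Ins (Load 2 12) ;; Ins (Add 3 2 2) ;; Ins (Add 4 3 3) ;; Ins (Add 3 3 4) ;;
    Ins (Add 3 3 1) ;; Ins (Add 4 3 2) ;; Ins (Add 5 4 2) ;;
    Ins (Copy 10 1) ;; Ins (Copy 9 2) ;; Ins (Copy 12 3) ;;
    Loop 9 (Ins (Store 12 10) ;; Ins (Load 11 10) ;; Ins (Add 10 10 11) ;; Ins (Add 10 10 1) ;;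
      Ins (Add 12 12 1) ;; Ins (Sub 9 9 1))"

text \<open>The tail is incremented before it is stored, so the recorded place is shifted by 1 and 0
  keeps meaning undiscovered.\<close>

definition discover_code :: com where
  "discover_code =
    Ins (Add 13 5 12) ;; Ins (Load 14 13) ;;
    Cond 14 Nop (Ins (Add 15 4 7) ;; Ins (Store 15 12) ;; Ins (Add 7 7 1) ;; Ins (Store 13 7))"

definition open_vertex_code :: com where
  "open_vertex_code =
    Ins (Add 12 4 6) ;; Ins (Load 12 12) ;; Ins (Add 12 3 12) ;; Ins (Load 10 12) ;; Ins (Load 11 10)"

text \<open>The truncated difference of tail and head is nonzero exactly when the queue is
  nonempty.\<close>

definition bfs_code :: com where
  "bfs_code = Ins (Add 9 2 2) ;;
    Loop 9 (
      Ins (Sub 12 7 6) ;;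
      Cond 12
        (open_vertex_code ;;
         Loop 11 (Ins (Add 10 10 1) ;; Ins (Load 12 10) ;; discover_code ;; Ins (Sub 11 11 1)) ;;
         Ins (Add 6 6 1))
        (Ins (Copy 12 8) ;; discover_code ;; Ins (Add 8 8 1)) ;;
      Ins (Sub 9 9 1))"

context adjacency
begin

section \<open>Memory layout of the input and the search data\<close>

definition input :: "nat list" where
  "input = n # concat (map (\<lambda>v. length (adj v) # adj v) [0..<n])"

primrec offset :: "nat \<Rightarrow> nat" where
  "offset 0 = 1"
| "offset (Suc v) = offset v + length (adj v) + 1"

lemma offset_le: "v \<le> n \<Longrightarrow> offset v \<le> 6 * v + 1"
proof (induction v)
  case (Suc v)
  have "offset v \<le> 6 * v + 1" using Suc.prems by (intro Suc.IH) linarith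
  moreover have "length (adj v) \<le> 5" using Suc.prems by (intro length_adj) linarith
  ultimately show ?case unfolding offset.simps mult_Suc_right by linarith
qed simp

lemma input_split:
  assumes "v < n"
  shows "\<exists>pre post. input = pre @ length (adj v) # adj v @ post \<and> length pre = offset v"
proof -
  have len: "Suc (length (concat (map (\<lambda>v. length (adj v) # adj v) [0..<v]))) = offset v" for v
    by (induction v) auto
  have "[0..<n] = [0..<v] @ v # [Suc v..<n]"
    using assms by (metis upt_add_eq_append upt_conv_Cons le_add_diff_inverse less_imp_le le0)
  then have "input = (n # concat (map (\<lambda>v. length (adj v) # adj v) [0..<v])) @
      length (adj v) # adj v @ concat (map (\<lambda>v. length (adj v) # adj v) [Suc v..<n])"
    by (simp add: input_def)
  then show ?thesis
    using len[of v] by (intro exI[of _ "n # concat (map (\<lambda>v. length (adj v) # adj v) [0..<v])"]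
      exI[of _ "concat (map (\<lambda>v. length (adj v) # adj v) [Suc v..<n])"]) auto
qed

lemma input_bound: "x \<in> set input \<Longrightarrow> x \<le> n + 5"
proof -
  assume "x \<in> set input"
  then consider "x = n" | v where "v < n" "x = length (adj v)" | v where "v < n" "x \<in> set (adj v)"
    by (auto simp: input_def)
  then show "x \<le> n + 5"
  proof cases
    case 2 then show ?thesis using length_adj[of v] by simp
  next
    case 3 then show ?thesis using set_adj[of v] E_subset by auto
  qed simp
qed

lemma length_input: "length input \<le> 6 * n + 1"
proof -
  have "Suc (length (concat (map (\<lambda>v. length (adj v) # adj v) [0..<v]))) = offset v" for v
    by (induction v) auto
  then have "length input = offset n" by (simp add: input_def)
  then show ?thesis using offset_le[of n] by simp
qed

lemma input_nth:
  assumes "v < n"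
  shows "input ! offset v = length (adj v)" "offset v + length (adj v) < length input"
    "k < length (adj v) \<Longrightarrow> input ! (offset v + 1 + k) = adj v ! k"
proof -
  obtain pre post where "input = pre @ length (adj v) # adj v @ post" "length pre = offset v"
    using input_split[OF assms] by blast
  then show "input ! offset v = length (adj v)" "offset v + length (adj v) < length input"
    "k < length (adj v) \<Longrightarrow> input ! (offset v + 1 + k) = adj v ! k"
    by (auto simp: nth_append)
qed

definition stored :: "config \<Rightarrow> bool" where
  "stored s \<longleftrightarrow> regs s 1 = 1 \<and> regs s 2 = n \<and> regs s 3 = 6 * n + 1 \<and> regs s 4 = 7 * n + 1 \<and>
    regs s 5 = 8 * n + 1 \<and> (\<forall>a<length input. mem s a = input ! a)"

definition bfs_stored :: "nat list \<Rightarrow> config \<Rightarrow> bool" where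
  "bfs_stored xs s \<longleftrightarrow> stored s \<and> (\<forall>v<n. mem s (6 * n + 1 + v) = offset v) \<and>
    distinct xs \<and> set xs \<subseteq> {..<n} \<and> regs s 7 = length xs \<and>
    (\<forall>i<length xs. mem s (7 * n + 1 + i) = xs ! i \<and> mem s (8 * n + 1 + xs ! i) = Suc i) \<and>
    (\<forall>u<n. u \<notin> set xs \<longrightarrow> mem s (8 * n + 1 + u) = 0)"

lemma bfs_stored_nth: "bfs_stored xs s \<Longrightarrow> i < length xs \<Longrightarrow> xs ! i < n"
  using nth_mem[of i xs] unfolding bfs_stored_def by blast

lemma bfs_stored_frame:
  "bfs_stored xs s \<Longrightarrow> mem s' = mem s \<Longrightarrow> (\<And>r. r \<in> {1..5} \<or> r = 7 \<Longrightarrow> regs s' r = regs s r) \<Longrightarrow>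
    bfs_stored xs s'"
  by (simp add: bfs_stored_def stored_def)

lemma bfs_stored_tick [simp]: "bfs_stored xs (tick s) = bfs_stored xs s"
  by (simp add: bfs_stored_def stored_def tick_def)

lemma tick_simps [simp]: "regs (tick s) = regs s" "mem (tick s) = mem s" "pc (tick s) = Suc (pc s)"
  by (simp_all add: tick_def)

lemma wp_setup:
  assumes w: "20 * n + 20 < 2 ^ w"
    and "regs s = (\<lambda>_. 0)" "mem s = (\<lambda>a. if a < length input then input ! a else 0)"
  shows "wp w setup_code (\<lambda>s'. bfs_stored [] s' \<and> regs s' 6 = 0 \<and> regs s' 8 = 0 \<and>
    pc s' \<le> pc s + 8 * n + 20) s"
proof -
  define I where "I i s' \<longleftrightarrow> stored s' \<and> regs s' 6 = 0 \<and> regs s' 7 = 0 \<and> regs s' 8 = 0 \<and>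
      regs s' 9 = n - i \<and> regs s' 10 = offset i \<and> regs s' 12 = 6 * n + 1 + i \<and>
      (\<forall>v<i. mem s' (6 * n + 1 + v) = offset v) \<and> (\<forall>a\<ge>7 * n + 1. mem s' a = 0) \<and>
      pc s' \<le> pc s + 11 + 8 * i" for i s'
  have input0: "input ! 0 = n" by (simp add: input_def)
  have loop: "regs t 9 \<noteq> 0 \<and> wp w (Ins (Store 12 10) ;; Ins (Load 11 10) ;; Ins (Add 10 10 11) ;;
      Ins (Add 10 10 1) ;; Ins (Add 12 12 1) ;; Ins (Sub 9 9 1)) (\<lambda>s'. I (Suc i) (tick s')) (tick t)"
    if "i < n" "I i t" for i t
  proof -
    \<comment> \<open>The address is stored before the degree is read; the bound on
      \<open>offset i\<close> shows that the degree cell is not overwritten.\<close>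
    have deg: "mem t (offset i) = length (adj i)" "length (adj i) \<le> 5" "offset i \<noteq> 6 * n + 1 + i"
        "offset i \<le> 6 * n"
      using that input_nth[OF that(1)] length_input length_adj[OF that(1)] by (auto simp: I_def stored_def)
    have "stored (t\<lparr>mem := (mem t)(6 * n + 1 + i := offset i)\<rparr>)"
      using that(2) length_input by (simp add: I_def stored_def)
    then show ?thesis
      using that deg w by (auto simp: I_def tick_def stored_def less_Suc_eq)
  qed
  have "wp w (Loop 9 (Ins (Store 12 10) ;; Ins (Load 11 10) ;; Ins (Add 10 10 11) ;;
      Ins (Add 10 10 1) ;; Ins (Add 12 12 1) ;; Ins (Sub 9 9 1)))
    (\<lambda>s'. bfs_stored [] s' \<and> regs s' 6 = 0 \<and> regs s' 8 = 0 \<and> pc s' \<le> pc s + 8 * n + 20) t"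
    if "I 0 t" for t
    by (rule wp_Loop_count[where I = I and N = n, OF that loop])
      (auto simp: I_def bfs_stored_def tick_def stored_def)
  moreover have "0 < length input" by (simp add: input_def)
  ultimately show ?thesis
    unfolding setup_code_def using w assms(2,3) length_input input0
    by (simp add: I_def stored_def)
qed

lemma wp_discover:
  assumes w: "20 * n + 20 < 2 ^ w" and s: "bfs_stored xs s" "regs s 12 = u" "u < n"
  shows "wp w discover_code (\<lambda>s'. bfs_stored (discover xs u) s' \<and>
    (\<forall>r. r \<notin> {7, 13, 14, 15} \<longrightarrow> regs s' r = regs s r) \<and> pc s' \<le> pc s + 8) s"
proof (cases "u \<in> set xs")
  case True
  then obtain i where "i < length xs" "xs ! i = u" by (auto simp: in_set_conv_nth)
  then have "mem s (8 * n + 1 + u) = Suc i" using s by (auto simp: bfs_stored_def)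
  then show ?thesis
    using s w True by (simp add: discover_code_def bfs_stored_def stored_def discover_def tick_def)
next
  case False
  then have new: "mem s (8 * n + 1 + u) = 0" using s by (auto simp: bfs_stored_def)
  have "insert u (set xs) \<subseteq> {..<n}" "distinct xs" using s by (auto simp: bfs_stored_def)
  \<comment> \<open>A free place is left in the order array, so the new entry does not run into the
    array of recorded places behind it.\<close>
  then have len: "length xs < n"
    using False card_mono[of "{..<n}" "insert u (set xs)"] by (simp add: distinct_card)
  have upd: "bfs_stored (xs @ [u]) s'"
    if "mem s' = (mem s)(7 * n + 1 + length xs := u, 8 * n + 1 + u := Suc (length xs))"
      "regs s' 7 = Suc (length xs)" "\<And>r. r \<in> {1..5} \<Longrightarrow> regs s' r = regs s r" for s'
  proof -
    have "xs ! i \<noteq> u" "xs ! i < n" if "i < length xs" for i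
      using that False bfs_stored_nth[OF s(1)] by auto
    then show ?thesis
      using s that False len length_input
      by (auto simp: bfs_stored_def stored_def nth_append less_Suc_eq)
  qed
  have "regs s 1 = 1" "regs s 4 = 7 * n + 1" "regs s 5 = 8 * n + 1" "regs s 7 = length xs"
    using s(1) by (auto simp: bfs_stored_def stored_def)
  then show ?thesis
    using s w False new len by (simp add: discover_code_def discover_def tick_def) (rule upd; simp)
qed

lemma wp_open_vertex:
  assumes w: "20 * n + 20 < 2 ^ w" and s: "bfs_stored xs s" "regs s 6 = h" "h < length xs"
  shows "wp w open_vertex_code (\<lambda>s'. regs s' 10 = offset (xs ! h) \<and> regs s' 11 = length (adj (xs ! h)) \<and>
    mem s' = mem s \<and> (\<forall>r. r \<notin> {10, 11, 12} \<longrightarrow> regs s' r = regs s r) \<and> pc s' = pc s + 5) s"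
proof -
  have v: "xs ! h < n" using s(1,3) by (rule bfs_stored_nth)
  have "length xs \<le> n" using s length_distinct_le by (auto simp: bfs_stored_def)
  moreover have "mem s (7 * n + 1 + h) = xs ! h" "mem s (6 * n + 1 + xs ! h) = offset (xs ! h)"
    "mem s (offset (xs ! h)) = length (adj (xs ! h))"
    using s v input_nth[OF v] by (auto simp: bfs_stored_def stored_def)
  ultimately show ?thesis
    using s v w by (simp add: open_vertex_code_def bfs_stored_def stored_def)
qed

lemma wp_explore:
  assumes w: "20 * n + 20 < 2 ^ w" and s: "bfs_stored xs s" "v < n" "regs s 10 = offset v"
    "regs s 11 = length (adj v)"
  shows "wp w (Loop 11 (Ins (Add 10 10 1) ;; Ins (Load 12 10) ;; discover_code ;; Ins (Sub 11 11 1)))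
    (\<lambda>s'. bfs_stored (foldl discover xs (adj v)) s' \<and>
      (\<forall>r. r \<in> {6, 8, 9} \<longrightarrow> regs s' r = regs s r) \<and> pc s' \<le> pc s + 66) s"
proof -
  \<comment> \<open>A round costs at most 13 ticks: 8 for \<open>discover_code\<close>, 3 other
    instructions, test and jump. With 5 neighbours and the final test this gives 66.\<close>
  define I where "I i s' \<longleftrightarrow> bfs_stored (foldl discover xs (take i (adj v))) s' \<and>
      regs s' 10 = offset v + i \<and> regs s' 11 = length (adj v) - i \<and>
      (\<forall>r. r \<in> {6, 8, 9} \<longrightarrow> regs s' r = regs s r) \<and> pc s' \<le> pc s + 13 * i" for i s'
  have loop: "regs t 11 \<noteq> 0 \<and> wp w (Ins (Add 10 10 1) ;; Ins (Load 12 10) ;; discover_code ;; Ins (Sub 11 11 1))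
      (\<lambda>s'. I (Suc i) (tick s')) (tick t)" if i: "i < length (adj v)" and t: "I i t" for i t
  proof -
    define t' where "t' = t\<lparr>pc := Suc (Suc (Suc (pc t))), regs := (regs t)(10 := Suc (offset v + i), 12 := adj v ! i)\<rparr>"
    have u: "adj v ! i < n" using set_adj[OF s(2)] E_subset nth_mem[OF i] by blast
    have nb: "mem t (offset v + 1 + i) = adj v ! i"
      using t input_nth[OF s(2)] i by (auto simp: I_def bfs_stored_def stored_def)
    have "offset v + 1 + i < 2 ^ w" using input_nth(2)[OF s(2)] i length_input w by simp
    have "bfs_stored (foldl discover xs (take i (adj v))) t'"
    proof (rule bfs_stored_frame)
      show "bfs_stored (foldl discover xs (take i (adj v))) t" using t by (simp add: I_def)
    qed (auto simp: t'_def)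
    then have "wp w discover_code (wp w (Ins (Sub 11 11 1)) (\<lambda>s'. I (Suc i) (tick s'))) t'"
    proof (rule wp_mono[OF wp_discover[OF w _ _ u]])
      show "regs t' 12 = adj v ! i" by (simp add: t'_def)
      fix s' assume s': "bfs_stored (discover (foldl discover xs (take i (adj v))) (adj v ! i)) s' \<and>
        (\<forall>r. r \<notin> {7, 13, 14, 15} \<longrightarrow> regs s' r = regs t' r) \<and> pc s' \<le> pc t' + 8"
      let ?s = "tick (exec_instr (Sub 11 11 1) s')"
      have "bfs_stored (foldl discover xs (take (Suc i) (adj v))) s'"
        using s' i by (simp add: take_Suc_conv_app_nth)
      then have "bfs_stored (foldl discover xs (take (Suc i) (adj v))) ?s"
        by (rule bfs_stored_frame) auto
      moreover have "regs s' 1 = 1" using s' by (simp add: bfs_stored_def stored_def)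
      ultimately show "wp w (Ins (Sub 11 11 1)) (\<lambda>s'. I (Suc i) (tick s')) s'"
        using s' t i by (auto simp: I_def t'_def tick_def)
    qed
    moreover have "regs t 1 = 1" "regs t 10 = offset v + i" "regs t 11 = length (adj v) - i"
      using t by (auto simp: I_def bfs_stored_def stored_def)
    ultimately show ?thesis
      using i nb \<open>offset v + 1 + i < 2 ^ w\<close> by (simp add: t'_def tick_def)
  qed
  have "I 0 s" using s by (simp add: I_def)
  then show ?thesis
  proof (rule wp_Loop_count[where I = I and N = "length (adj v)", OF _ loop])
    fix t assume "I (length (adj v)) t"
    then show "regs t 11 = 0 \<and> bfs_stored (foldl discover xs (adj v)) (tick t) \<and>
      (\<forall>r. r \<in> {6, 8, 9} \<longrightarrow> regs (tick t) r = regs s r) \<and> pc (tick t) \<le> pc s + 66"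
      using length_adj[OF s(2)] by (simp add: I_def)
  qed
qed

lemma wp_bfs:
  assumes w: "20 * n + 20 < 2 ^ w" and s: "bfs_stored [] s" "regs s 6 = 0" "regs s 8 = 0"
  shows "wp w bfs_code (\<lambda>s'. bfs_stored bfs_order s' \<and> pc s' \<le> pc s + 160 * n + 2) s"
proof -
  let ?explore = "Loop 11 (Ins (Add 10 10 1) ;; Ins (Load 12 10) ;; discover_code ;; Ins (Sub 11 11 1))"
  let ?body = "Ins (Sub 12 7 6) ;; Cond 12
    (open_vertex_code ;; ?explore ;; Ins (Add 6 6 1))
    (Ins (Copy 12 8) ;; discover_code ;; Ins (Add 8 8 1)) ;; Ins (Sub 9 9 1)"
  define J where "J xs h s0 s' \<longleftrightarrow> bfs_stored xs s' \<and> regs s' 6 = h \<and> regs s' 8 = s0" for xs h s0 s'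
  \<comment> \<open>A round takes at most 78 ticks: 66 for the neighbours, 5 for opening the vertex,
    7 for control and counters.\<close>
  define I where "I k s' \<longleftrightarrow> (case bfs k of (xs, h, s0) \<Rightarrow> J xs h s0 s') \<and>
      regs s' 9 = 2 * n - k \<and> pc s' \<le> pc s + 1 + 80 * k" for k s'
  have loop: "regs t 9 \<noteq> 0 \<and> wp w ?body (\<lambda>s'. I (Suc k) (tick s')) (tick t)"
    if k: "k < 2 * n" and t: "I k t" for k t
  proof -
    obtain xs h s0 where b: "bfs k = (xs, h, s0)" by (metis prod_cases3)
    have inv: "bfs_inv k (xs, h, s0)" using bfs_inv[of k] k b by simp
    have t': "bfs_stored xs t" "regs t 6 = h" "regs t 8 = s0" "regs t 9 = 2 * n - k"
      "pc t \<le> pc s + 1 + 80 * k" "regs t 1 = 1" "regs t 7 = length xs"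
      using t b by (auto simp: I_def J_def bfs_stored_def stored_def)
    have hn: "h \<le> n" "s0 \<le> n" "length xs \<le> n" using inv bfs_inv_length[OF inv] by (auto simp: bfs_inv_def)
    have last: "wp w (Ins (Sub 9 9 1)) (\<lambda>s'. I (Suc k) (tick s')) s'"
      if "bfs (Suc k) = (xs', h', s0')" "J xs' h' s0' s'" "regs s' 9 = 2 * n - k" "pc s' \<le> pc t + 78"
      for xs' h' s0' s'
    proof -
      have "bfs_stored xs' (exec_instr (Sub 9 9 1) s')"
        by (rule bfs_stored_frame[of xs' s']) (use that in \<open>auto simp: J_def\<close>)
      moreover have "regs s' 1 = 1" using that(2) by (auto simp: J_def bfs_stored_def stored_def)
      moreover have "2 * n - k - 1 = 2 * n - Suc k" by simp
      ultimately show ?thesis using that t'(5) by (simp add: I_def J_def)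
    qed
    define t1 where "t1 = exec_instr (Sub 12 7 6) (tick t)"
    have t1: "bfs_stored xs (tick t1)" "regs t1 6 = h" "regs t1 8 = s0" "regs t1 9 = 2 * n - k"
      "regs t1 12 = length xs - h" "pc t1 = pc t + 2"
      using t' by (auto simp: t1_def intro: bfs_stored_frame[OF t'(1)])
    have "wp w (Cond 12 (open_vertex_code ;; ?explore ;; Ins (Add 6 6 1))
      (Ins (Copy 12 8) ;; discover_code ;; Ins (Add 8 8 1)))
      (wp w (Ins (Sub 9 9 1)) (\<lambda>s'. I (Suc k) (tick s'))) t1"
    proof (cases "h < length xs")
      case True
      have v: "xs ! h < n" using t'(1) True by (rule bfs_stored_nth)
      have "wp w open_vertex_code (wp w (?explore ;; Ins (Add 6 6 1))
        (\<lambda>s'. wp w (Ins (Sub 9 9 1)) (\<lambda>s'. I (Suc k) (tick s')) (tick s'))) (tick t1)"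
      proof (rule wp_mono[OF wp_open_vertex[OF w t1(1) _ True]])
        show "regs (tick t1) 6 = h" using t1 by simp
        fix u :: config assume u: "regs u 10 = offset (xs ! h) \<and> regs u 11 = length (adj (xs ! h)) \<and>
          mem u = mem (tick t1) \<and> (\<forall>r. r \<notin> {10, 11, 12} \<longrightarrow> regs u r = regs (tick t1) r) \<and>
          pc u = pc (tick t1) + 5"
        have bu: "bfs_stored xs u" by (rule bfs_stored_frame[OF t1(1)]) (use u in auto)
        have "wp w ?explore (wp w (Ins (Add 6 6 1))
          (\<lambda>s'. wp w (Ins (Sub 9 9 1)) (\<lambda>s'. I (Suc k) (tick s')) (tick s'))) u"
        proof (rule wp_mono[OF wp_explore[OF w bu v]])
          fix x :: config assume x: "bfs_stored (foldl discover xs (adj (xs ! h))) x \<and>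
            (\<forall>r. r \<in> {6, 8, 9} \<longrightarrow> regs x r = regs u r) \<and> pc x \<le> pc u + 66"
          have "J (foldl discover xs (adj (xs ! h))) (Suc h) s0 (tick (exec_instr (Add 6 6 1) x))"
            unfolding J_def
          proof (intro conjI)
            show "bfs_stored (foldl discover xs (adj (xs ! h))) (tick (exec_instr (Add 6 6 1) x))"
              by (rule bfs_stored_frame[of _ x]) (use x in auto)
          qed (use x u t1 in \<open>auto simp: bfs_stored_def stored_def\<close>)
          then have "wp w (Ins (Sub 9 9 1)) (\<lambda>s'. I (Suc k) (tick s')) (tick (exec_instr (Add 6 6 1) x))"
            by (rule last[rotated]) (use x u t1 b True in \<open>auto simp: bfs_Suc\<close>)
          moreover have "regs x 6 + regs x 1 < 2 ^ w"
            using x u t1 hn w by (auto simp: bfs_stored_def stored_def)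
          ultimately show "wp w (Ins (Add 6 6 1))
            (\<lambda>s'. wp w (Ins (Sub 9 9 1)) (\<lambda>s'. I (Suc k) (tick s')) (tick s')) x" by simp
        qed (use u in auto)
        then show "wp w (?explore ;; Ins (Add 6 6 1))
          (\<lambda>s'. wp w (Ins (Sub 9 9 1)) (\<lambda>s'. I (Suc k) (tick s')) (tick s')) u" by simp
      qed
      then show ?thesis using True t1(5) by simp
    next
      case False
      have "s0 < n" using bfs_inv_next_start[OF inv k False] .
      let ?t = "exec_instr (Copy 12 8) (tick t1)"
      have bt: "bfs_stored xs ?t" by (rule bfs_stored_frame[OF t1(1)]) auto
      have "wp w discover_code (wp w (Ins (Add 8 8 1)) (wp w (Ins (Sub 9 9 1)) (\<lambda>s'. I (Suc k) (tick s')))) ?t"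
      proof (rule wp_mono[OF wp_discover[OF w bt _ \<open>s0 < n\<close>]])
        show "regs ?t 12 = s0" using t1 by simp
        fix x :: config assume x: "bfs_stored (discover xs s0) x \<and>
          (\<forall>r. r \<notin> {7, 13, 14, 15} \<longrightarrow> regs x r = regs ?t r) \<and> pc x \<le> pc ?t + 8"
        have "J (discover xs s0) h (Suc s0) (exec_instr (Add 8 8 1) x)"
          unfolding J_def
        proof (intro conjI)
          show "bfs_stored (discover xs s0) (exec_instr (Add 8 8 1) x)"
            by (rule bfs_stored_frame[of _ x]) (use x in auto)
          show "regs (exec_instr (Add 8 8 1) x) 8 = Suc s0"
            using x t1 t'(6) by (auto simp: t1_def)
        qed (use x t1 in auto)
        then have "wp w (Ins (Sub 9 9 1)) (\<lambda>s'. I (Suc k) (tick s')) (exec_instr (Add 8 8 1) x)"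
          by (rule last[rotated]) (use x t1 b False in \<open>auto simp: bfs_Suc\<close>)
        moreover have "regs x 8 + regs x 1 < 2 ^ w"
          using x t1 hn w by (auto simp: bfs_stored_def stored_def)
        ultimately show "wp w (Ins (Add 8 8 1)) (wp w (Ins (Sub 9 9 1)) (\<lambda>s'. I (Suc k) (tick s'))) x"
          by simp
      qed
      then show ?thesis using False t1(5) by simp
    qed
    then have "wp w ?body (\<lambda>s'. I (Suc k) (tick s')) (tick t)" by (simp add: t1_def)
    moreover have "regs t 9 \<noteq> 0" using t'(4) k by simp
    ultimately show ?thesis by blast
  qed
  let ?s = "exec_instr (Add 9 2 2) s"
  have n: "regs s 2 = n" using s(1) by (simp add: bfs_stored_def stored_def)
  have "bfs_stored [] ?s" by (rule bfs_stored_frame[OF s(1)]) auto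
  then have "I 0 ?s" using s n by (simp add: I_def J_def)
  then have "wp w (Loop 9 ?body) (\<lambda>s'. bfs_stored bfs_order s' \<and> pc s' \<le> pc s + 160 * n + 2) ?s"
  proof (rule wp_Loop_count[where I = I and N = "2 * n", OF _ loop])
    fix t assume "I (2 * n) t"
    then show "regs t 9 = 0 \<and> bfs_stored bfs_order (tick t) \<and> pc (tick t) \<le> pc s + 160 * n + 2"
      by (simp add: I_def J_def bfs_final)
  qed
  then show ?thesis using w n by (simp add: bfs_code_def)
qed

end

section \<open>The complete program\<close>

text \<open>The recorded place is already shifted by 1, so adding 71 (register 16) gives place plus
  72. Truncated subtraction and the clamping of \<open>table2\<close> then produce exactly the
  offsets on which overlong arcs are rejected.\<close>

definition feed_vertex_code :: "nat \<Rightarrow> (nat \<Rightarrow> nat \<Rightarrow> nat) \<Rightarrow> com" where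
  "feed_vertex_code K f =
    Loop 11 (Ins (Add 10 10 1) ;; Ins (Load 12 10) ;; Ins (Add 12 5 12) ;; Ins (Load 12 12) ;;
      Ins (Add 12 12 16) ;; Ins (Sub 12 12 6) ;; table2 12 K (2 * 72) f ;; Ins (Sub 11 11 1))"

definition feed_code ::
  "nat \<Rightarrow> nat \<Rightarrow> (nat \<Rightarrow> nat \<Rightarrow> nat) \<Rightarrow> (nat \<Rightarrow> nat) \<Rightarrow> (nat \<Rightarrow> nat) \<Rightarrow> com" where
  "feed_code K q0 f g a =
    Ins (Const 16 71) ;; Ins (Const 0 q0) ;; Ins (Const 6 0) ;; Ins (Copy 9 2) ;;
    Loop 9 (open_vertex_code ;; feed_vertex_code K f ;; table K g ;;
      Ins (Add 6 6 1) ;; Ins (Sub 9 9 1)) ;;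
    table K a"

context adjacency
begin

definition rank :: "nat \<Rightarrow> nat" where
  "rank = the_inv_into {..<n} ((!) bfs_order)"

lemma rank_nth: "i < n \<Longrightarrow> rank (bfs_order ! i) = i"
  unfolding rank_def using distinct_bfs_order length_bfs_order
  by (intro the_inv_into_f_f) (auto simp: inj_on_def nth_eq_iff_index_eq)

lemma bfs_stored_rank:
  assumes "bfs_stored bfs_order s" "u < n"
  shows "mem s (8 * n + 1 + u) = Suc (rank u)" "rank u < n"
proof -
  have "u \<in> set bfs_order" using assms(2) by (simp add: set_bfs_order)
  then obtain i where "i < n" "bfs_order ! i = u" by (auto simp: in_set_conv_nth length_bfs_order)
  moreover from this have "rank u = i" using rank_nth by blast
  ultimately show "mem s (8 * n + 1 + u) = Suc (rank u)" "rank u < n"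
    using assms(1) by (auto simp: bfs_stored_def length_bfs_order)
qed

lemma foldl_less:
  "q < K \<Longrightarrow> (\<And>q e. q < K \<Longrightarrow> e \<in> set es \<Longrightarrow> f q e < K) \<Longrightarrow> foldl f q es < (K :: nat)"
  by (induction es arbitrary: q) auto

lemma wp_feed_vertex:
  assumes w: "20 * n + K + 200 < 2 ^ w" and s: "bfs_stored bfs_order s" "v < n"
    and r: "regs s 0 = q" "regs s 6 = i" "regs s 10 = offset v" "regs s 11 = length (adj v)" "regs s 16 = 71"
    and f: "\<And>q e. q < K \<Longrightarrow> e \<le> 2 * 72 \<Longrightarrow> f q e < K" and q: "q < K"
  shows "wp w (feed_vertex_code K f)
    (\<lambda>s'. bfs_stored bfs_order s' \<and>
      regs s' 0 = foldl f q (map (\<lambda>u. min (rank u + 72 - i) (2 * 72)) (adj v)) \<and>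
      (\<forall>r. r \<in> {6, 9, 16} \<longrightarrow> regs s' r = regs s r) \<and> pc s' \<le> pc s + (15 * K + 2300)) s"
proof -
  define M where "M = map (\<lambda>u. min (rank u + 72 - i) (2 * 72)) (adj v)"
  \<comment> \<open>The two-dimensional lookup takes at most \<open>3 * K + 436\<close> ticks, the
    rest of a round 9.\<close>
  define I where "I k s' \<longleftrightarrow> bfs_stored bfs_order s' \<and> regs s' 0 = foldl f q (take k M) \<and>
      regs s' 10 = offset v + k \<and> regs s' 11 = length (adj v) - k \<and>
      (\<forall>r. r \<in> {6, 9, 16} \<longrightarrow> regs s' r = regs s r) \<and> pc s' \<le> pc s + (3 * K + 450) * k" for k s'
  let ?next = "wp w (Ins (Sub 11 11 1))"
  let ?body = "Ins (Add 10 10 1) ;; Ins (Load 12 10) ;; Ins (Add 12 5 12) ;; Ins (Load 12 12) ;;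
      Ins (Add 12 12 16) ;; Ins (Sub 12 12 6) ;; table2 12 K (2 * 72) f ;; Ins (Sub 11 11 1)"
  have loop: "regs t 11 \<noteq> 0 \<and> wp w ?body (\<lambda>s'. I (Suc k) (tick s')) (tick t)"
    if k: "k < length (adj v)" and t: "I k t" for k t
  proof -
    define u where "u = adj v ! k"
    define t' where "t' = t\<lparr>pc := Suc (Suc (Suc (Suc (Suc (Suc (Suc (pc t))))))),
      regs := (regs t)(10 := Suc (offset v + k), 12 := rank u + 72 - i)\<rparr>"
    have regs_t: "bfs_stored bfs_order t" "regs t 1 = 1" "regs t 5 = 8 * n + 1" "regs t 6 = i" "regs t 16 = 71"
      "regs t 10 = offset v + k" "regs t 11 = length (adj v) - k" "regs t 0 = foldl f q (take k M)"
      using t r by (auto simp: I_def bfs_stored_def stored_def)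
    have u: "u < n" using set_adj[OF s(2)] E_subset nth_mem[OF k] unfolding u_def by blast
    have nb: "mem t (offset v + 1 + k) = u"
      using regs_t(1) input_nth[OF s(2)] k by (auto simp: u_def bfs_stored_def stored_def)
    have p: "offset v + 1 + k < 2 ^ w" using input_nth(2)[OF s(2)] k length_input w by simp
    have rank_u: "mem t (8 * n + 1 + u) = Suc (rank u)" "rank u < n"
      using bfs_stored_rank[OF regs_t(1) u] .
    have q': "foldl f q (take k M) < K"
      using q f by (intro foldl_less) (auto simp: M_def dest!: in_set_takeD)
    have min: "min (rank u + 72 - i) (2 * 72) = M ! k" using k by (simp add: M_def u_def)
    have bt: "bfs_stored bfs_order t'"
      by (rule bfs_stored_frame[OF regs_t(1)]) (auto simp: t'_def)
    have "wp w (table2 12 K (2 * 72) f) (?next (\<lambda>s'. I (Suc k) (tick s'))) t'"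
    proof (rule wp_mono[OF wp_table2])
      show "regs t' 1 = 1" "regs t' 0 < K" using regs_t q' by (auto simp: t'_def)
      show "f q e < 2 ^ w" if "q < K" "e \<le> 2 * 72" for q e using f[OF that] w by simp
      fix x :: config
      assume x: "yields t' (f (regs t' 0) (min (regs t' 12) (2 * 72))) {0, 12}
        (1 + 3 * K + 3 * Suc (2 * 72)) x"
      have x': "mem x = mem t'" "\<And>r. r \<notin> {0, 12} \<Longrightarrow> regs x r = regs t' r"
        "pc x \<le> pc t' + (1 + 3 * K + 3 * Suc (2 * 72))" "regs x 0 = f (regs t' 0) (min (regs t' 12) (2 * 72))"
        using x by (auto simp: yields_def)
      have "regs x 0 = foldl f q (take (Suc k) M)"
        using x'(4) regs_t(8) min k by (simp add: t'_def take_Suc_conv_app_nth M_def)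
      moreover have "bfs_stored bfs_order (exec_instr (Sub 11 11 1) x)"
        by (rule bfs_stored_frame[OF bt]) (use x' in auto)
      moreover have "regs x 1 = 1" "regs x 11 = length (adj v) - k" "regs x 10 = Suc (offset v + k)"
        using x'(2) regs_t by (auto simp: t'_def)
      moreover have "regs x r = regs s r" if "r \<in> {6, 9, 16}" for r
        using x'(2) t that by (auto simp: t'_def I_def)
      moreover have "pc x \<le> pc s + (3 * K + 450) * k + (3 * K + 443)"
        using x'(3) t by (simp add: t'_def I_def)
      ultimately show "?next (\<lambda>s'. I (Suc k) (tick s')) x"
        by (auto simp: I_def algebra_simps)
    qed simp
    moreover have "rank u + 1 + 71 - i = rank u + 72 - i" by simp
    ultimately have "wp w ?body (\<lambda>s'. I (Suc k) (tick s')) (tick t)"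
      using regs_t u nb p rank_u w by (simp add: t'_def tick_def)
    then show ?thesis using regs_t(7) k by simp
  qed
  have "I 0 s" using s r by (simp add: I_def)
  then show ?thesis
    unfolding feed_vertex_code_def
  proof (rule wp_Loop_count[where I = I and N = "length (adj v)", OF _ loop])
    fix t assume t: "I (length (adj v)) t"
    have "(3 * K + 450) * length (adj v) \<le> (3 * K + 450) * 5"
      using length_adj[OF s(2)] by (intro mult_left_mono) auto
    then show "regs t 11 = 0 \<and> bfs_stored bfs_order (tick t) \<and>
      regs (tick t) 0 = foldl f q (map (\<lambda>u. min (rank u + 72 - i) (2 * 72)) (adj v)) \<and>
      (\<forall>r. r \<in> {6, 9, 16} \<longrightarrow> regs (tick t) r = regs s r) \<and> pc (tick t) \<le> pc s + (15 * K + 2300)"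
      using t by (simp add: I_def M_def)
  qed
qed

lemma wp_feed:
  assumes w: "20 * n + K + 200 < 2 ^ w" and s: "bfs_stored bfs_order s"
    and q0: "q0 < K" and f: "\<And>q e. q < K \<Longrightarrow> e \<le> 2 * 72 \<Longrightarrow> f q e < K"
    and g: "\<And>q. q < K \<Longrightarrow> g q < K" and a: "\<And>q. a q \<le> 1"
  shows "wp w (feed_code K q0 f g a)
    (\<lambda>s'. regs s' 0 = a (foldl (\<lambda>q i. g (foldl f q
        (map (\<lambda>u. min (rank u + 72 - i) (2 * 72)) (adj (bfs_order ! i))))) q0 [0..<n]) \<and>
      pc s' \<le> pc s + (20 * K + 2400) * (n + 1)) s"
proof -
  define M where "M i = map (\<lambda>u. min (rank u + 72 - i) (2 * 72)) (adj (bfs_order ! i))" for i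
  define Q where "Q i = foldl (\<lambda>q i. g (foldl f q (M i))) q0 [0..<i]" for i
  have Q_Suc: "Q (Suc i) = g (foldl f (Q i) (M i))" for i by (simp add: Q_def)
  have fM: "foldl f q (M i) < K" if "q < K" for q i
    using that f by (intro foldl_less) (auto simp: M_def)
  have Q_less: "Q i < K" for i
    using q0 g fM by (induction i) (auto simp: Q_def)
  define I where "I i s' \<longleftrightarrow> bfs_stored bfs_order s' \<and> regs s' 0 = Q i \<and> regs s' 6 = i \<and>
      regs s' 9 = n - i \<and> regs s' 16 = 71 \<and> pc s' \<le> pc s + 4 + (18 * K + 2320) * i" for i s'
  let ?next = "\<lambda>Q. wp w (Ins (Add 6 6 1)) (wp w (Ins (Sub 9 9 1)) Q)"
  let ?body = "open_vertex_code ;; feed_vertex_code K f ;; table K g ;; Ins (Add 6 6 1) ;; Ins (Sub 9 9 1)"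
  have w': "20 * n + 20 < 2 ^ w" using w by simp
  have loop: "regs t 9 \<noteq> 0 \<and> wp w ?body (\<lambda>s'. I (Suc i) (tick s')) (tick t)"
    if i: "i < n" and t: "I i t" for i t
  proof -
    have bt: "bfs_stored bfs_order (tick t)" "regs (tick t) 6 = i" using t by (auto simp: I_def)
    have v: "bfs_order ! i < n" using bt(1) i by (intro bfs_stored_nth) (auto simp: length_bfs_order)
    have "wp w open_vertex_code (wp w (feed_vertex_code K f) (wp w (table K g)
      (?next (\<lambda>s'. I (Suc i) (tick s'))))) (tick t)"
    proof (rule wp_mono[OF wp_open_vertex[OF w' bt]])
      show "i < length bfs_order" using i by (simp add: length_bfs_order)
      fix x :: config
      assume x: "regs x 10 = offset (bfs_order ! i) \<and> regs x 11 = length (adj (bfs_order ! i)) \<and>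
        mem x = mem (tick t) \<and> (\<forall>r. r \<notin> {10, 11, 12} \<longrightarrow> regs x r = regs (tick t) r) \<and>
        pc x = pc (tick t) + 5"
      have bx: "bfs_stored bfs_order x" by (rule bfs_stored_frame[OF bt(1)]) (use x in auto)
      show "wp w (feed_vertex_code K f) (wp w (table K g) (?next (\<lambda>s'. I (Suc i) (tick s')))) x"
      proof (rule wp_mono[OF wp_feed_vertex[OF w bx v, of "Q i" i f]])
        show "regs x 0 = Q i" "regs x 6 = i" "regs x 16 = 71" using x t by (auto simp: I_def)
        fix y :: config
        assume "bfs_stored bfs_order y \<and> regs y 0 = foldl f (Q i)
            (map (\<lambda>u. min (rank u + 72 - i) (2 * 72)) (adj (bfs_order ! i))) \<and>
          (\<forall>r. r \<in> {6, 9, 16} \<longrightarrow> regs y r = regs x r) \<and> pc y \<le> pc x + (15 * K + 2300)"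
        then have y: "bfs_stored bfs_order y" "regs y 0 = foldl f (Q i) (M i)"
          "regs y 6 = i" "regs y 9 = n - i" "regs y 16 = 71"
          "pc y \<le> pc s + 4 + (18 * K + 2320) * i + 6 + (15 * K + 2300)"
          using x t by (auto simp: I_def M_def)
        show "wp w (table K g) (?next (\<lambda>s'. I (Suc i) (tick s'))) y"
        proof (rule wp_mono[OF wp_table[of y K g w "{0}"]])
          show "regs y 1 = 1" using y(1) by (simp add: bfs_stored_def stored_def)
          show "regs y 0 < K" using y(2) fM[OF Q_less] by simp
          show "g k < 2 ^ w" if "k < K" for k using g[OF that] w by simp
          fix z :: config
          assume "yields y (g (regs y 0)) {0} (1 + 3 * K) z"
          then have z: "mem z = mem y" "\<And>r. r \<noteq> 0 \<Longrightarrow> regs z r = regs y r" "regs z 0 = Q (Suc i)"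
            "pc z \<le> pc y + (1 + 3 * K)"
            using y(2) by (auto simp: yields_def Q_Suc)
          have "regs z 1 = 1" using z(2)[of 1] y(1) by (simp add: bfs_stored_def stored_def)
          moreover have "bfs_stored bfs_order (exec_instr (Sub 9 9 1) (exec_instr (Add 6 6 1) z))"
            by (rule bfs_stored_frame[OF y(1)]) (use z in auto)
          ultimately show "?next (\<lambda>s'. I (Suc i) (tick s')) z"
            using z y(3-6) i w by (simp add: I_def)
        qed simp
      qed (use x f Q_less in auto)
    qed
    moreover have "regs t 9 \<noteq> 0" using t i by (simp add: I_def)
    ultimately show ?thesis by simp
  qed
  define s1 where "s1 = exec_instr (Copy 9 2) (exec_instr (Const 6 0)
    (exec_instr (Const 0 q0) (exec_instr (Const 16 71) s)))"
  have "bfs_stored bfs_order s1" by (rule bfs_stored_frame[OF s]) (auto simp: s1_def)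
  moreover have "regs s 2 = n" using s by (simp add: bfs_stored_def stored_def)
  ultimately have "I 0 s1" by (simp add: I_def s1_def Q_def)
  then have "wp w (Loop 9 ?body) (wp w (table K a) (\<lambda>s'. regs s' 0 = a (Q n) \<and>
      pc s' \<le> pc s + (20 * K + 2400) * (n + 1))) s1"
  proof (rule wp_Loop_count[where I = I and N = n, OF _ loop])
    fix t assume t: "I n t"
    then have t': "bfs_stored bfs_order t" "regs t 0 = Q n" "pc t \<le> pc s + 4 + (18 * K + 2320) * n"
      by (auto simp: I_def)
    have "wp w (table K a) (\<lambda>s'. regs s' 0 = a (Q n) \<and> pc s' \<le> pc s + (20 * K + 2400) * (n + 1)) (tick t)"
    proof (rule wp_mono[OF wp_table[of "tick t" K a w "{0}"]])
      show "regs (tick t) 1 = 1" using t'(1) by (simp add: bfs_stored_def stored_def)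
      show "regs (tick t) 0 < K" using t'(2) Q_less by simp
      show "a k < 2 ^ w" for k using a[of k] w by (simp add: le_less_trans)
      fix z :: config
      assume z: "yields (tick t) (a (regs (tick t) 0)) {0} (1 + 3 * K) z"
      then have "pc z \<le> pc s + 4 + (18 * K + 2320) * n + 1 + (1 + 3 * K)"
        using t'(3) by (simp add: yields_def)
      also have "\<dots> \<le> pc s + (20 * K + 2400) * (n + 1)" by (simp add: algebra_simps)
      finally show "regs z 0 = a (Q n) \<and> pc z \<le> pc s + (20 * K + 2400) * (n + 1)"
        using z t'(2) by (simp add: yields_def)
    qed simp
    then show "regs t 9 = 0 \<and> wp w (table K a) (\<lambda>s'. regs s' 0 = a (Q n) \<and>
      pc s' \<le> pc s + (20 * K + 2400) * (n + 1)) (tick t)"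
      using t by (simp add: I_def)
  qed
  then have "wp w (feed_code K q0 f g a) (\<lambda>s'. regs s' 0 = a (Q n) \<and>
      pc s' \<le> pc s + (20 * K + 2400) * (n + 1)) s"
    using w q0 by (simp add: feed_code_def s1_def)
  then show ?thesis by (simp add: Q_def M_def)
qed

end

text \<open>The clock starts at 0, so its final value is the running time, and code placed at
  address 0 halts by running off its end.\<close>

lemma wp_decides_within:
  assumes "wp w c (\<lambda>s'. regs s' 0 = (if b then 1 else 0) \<and> pc s' \<le> t) (initial_config xs)"
    and "\<And>x. x \<in> set xs \<Longrightarrow> x < 2 ^ w"
  shows "decides_within (compile 0 c) w t xs b"
proof -
  obtain s' where s': "exec w c (initial_config xs) s'" "regs s' 0 = (if b then 1 else 0)" "pc s' \<le> t"
    using assms(1) by (auto simp: wp_def)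
  have "fits_word_size w (initial_config xs)"
    using assms(2) by (auto simp: fits_word_size_def initial_config_def)
  then obtain k where k: "pc s' = pc (initial_config xs) + k"
    "runs (compile 0 c) w k ((initial_config xs)\<lparr>pc := 0\<rparr>) (s'\<lparr>pc := code_length c\<rparr>)"
    using exec_runs[OF s'(1), of "compile 0 c" "[]" "[]"] by auto
  have start: "(initial_config xs)\<lparr>pc := 0\<rparr> = initial_config xs" "pc (initial_config xs) = 0"
    by (simp_all add: initial_config_def)
  have "k \<le> t" using k(1) s'(3) start(2) by simp
  moreover note k(2)[unfolded start(1)]
  ultimately show ?thesis
    using s'(2) unfolding decides_within_def runs_def
    by (intro exI[of _ k]) (simp add: Let_def halted_def)
qed

lemma (in adjacency) wp_square_root:
  assumes w: "20 * n + K + 200 < 2 ^ w"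
    and A: "root_automaton 72 K q0 f g a"
  shows "wp w (setup_code ;; bfs_code ;; feed_code K q0 f g a)
    (\<lambda>s'. regs s' 0 = (if \<exists>R. is_root R E then 1 else 0) \<and> pc s' \<le> (20 * K + 2600) * (n + 1))
    (initial_config input)"
proof -
  let ?Q = "\<lambda>s'. regs s' 0 = (if \<exists>R. is_root R E then 1 else 0) \<and> pc s' \<le> (20 * K + 2600) * (n + 1)"
  let ?M = "\<lambda>i. map (\<lambda>u. min (rank u + 72 - i) (2 * 72)) (adj (bfs_order ! i))"
  have w': "20 * n + 20 < 2 ^ w" using w by simp
  note A' = A[unfolded root_automaton_def]
  note q0 = A'[THEN conjunct1]
  have f: "f q e < K" if "q < K" "e \<le> 2 * 72" for q e
    using A'[THEN conjunct2, THEN conjunct1] that by (elim allE impE)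
  have g: "g q < K" if "q < K" for q
    using A'[THEN conjunct2, THEN conjunct2, THEN conjunct1] that by (elim allE impE)
  have a: "a q \<le> 1" for q
    using A'[THEN conjunct2, THEN conjunct2, THEN conjunct2, THEN conjunct1] by (elim allE)
  have "\<forall>i<n. set (?M i) \<subseteq> {..2 * 72}" by auto
  with A'[THEN conjunct2, THEN conjunct2, THEN conjunct2, THEN conjunct2, THEN spec, of n, THEN spec, of ?M]
  have "a (foldl (\<lambda>q i. g (foldl f q (?M i))) q0 [0..<n]) =
      (if recognises_roots 72 (\<lambda>i. set (?M i)) n then 1 else 0)" by (rule mp)
  moreover have "recognises_roots 72 (\<lambda>i. set (?M i)) n \<longleftrightarrow> (\<exists>R. is_root R E)"
    by (rule recognises_roots_bfs_order) (rule rank_nth)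
  ultimately have result: "a (foldl (\<lambda>q i. g (foldl f q (?M i))) q0 [0..<n]) =
      (if \<exists>R. is_root R E then 1 else 0)"
    by (simp only:)
  have "wp w setup_code (wp w bfs_code (wp w (feed_code K q0 f g a) ?Q)) (initial_config input)"
  proof (rule wp_mono[OF wp_setup[OF w']])
    show "regs (initial_config input) = (\<lambda>_. 0)"
      "mem (initial_config input) = (\<lambda>a. if a < length input then input ! a else 0)"
      by (simp_all add: initial_config_def)
    fix s :: config
    assume "bfs_stored [] s \<and> regs s 6 = 0 \<and> regs s 8 = 0 \<and>
      pc s \<le> pc (initial_config input) + 8 * n + 20"
    then have s: "bfs_stored [] s" "regs s 6 = 0" "regs s 8 = 0" "pc s \<le> 8 * n + 20"
      by (auto simp: initial_config_def)
    show "wp w bfs_code (wp w (feed_code K q0 f g a) ?Q) s"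
    proof (rule wp_mono[OF wp_bfs[OF w' s(1-3)]])
      fix t :: config assume t: "bfs_stored bfs_order t \<and> pc t \<le> pc s + 160 * n + 2"
      show "wp w (feed_code K q0 f g a) ?Q t"
      proof (rule wp_mono[OF wp_feed[where f = f and g = g and a = a, OF w _ q0 f g a]])
        fix x :: config
        assume x: "regs x 0 = a (foldl (\<lambda>q i. g (foldl f q (?M i))) q0 [0..<n]) \<and>
          pc x \<le> pc t + (20 * K + 2400) * (n + 1)"
        then have "pc x \<le> 168 * n + 22 + (20 * K + 2400) * (n + 1)" using t s(4) by simp
        also have "\<dots> \<le> (20 * K + 2600) * (n + 1)" by (simp add: algebra_simps)
        finally show "?Q x" using x result by simp
      qed (use t in auto)
    qed
  qed
  then show ?thesis by simp
qed

text \<open>The lists are free of repetitions, so their lengths are the out-degrees; this turns the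
  degree bound into the bound on list lengths.\<close>

lemma adjacency_of_rep:
  assumes "pair_graph G" "\<forall>v\<in>pverts G. out_degree (with_proj G) v \<le> 5" "adjacency_list_rep n G xs"
  obtains adj where "adjacency n adj (parcs G)" "xs = adjacency.input n adj"
proof -
  interpret G: pair_graph G by fact
  obtain adj where V: "pverts G = {..<n}"
    and adj: "\<And>v. v < n \<Longrightarrow> distinct (adj v) \<and> set (adj v) = {u. v \<rightarrow>\<^bsub>with_proj G\<^esub> u}"
    and xs: "xs = n # concat (map (\<lambda>v. length (adj v) # adj v) [0..<n])"
    using assms(3) unfolding adjacency_list_rep_def by blast
  have set_adj: "set (adj v) = parcs G `` {v}" if "v < n" for v
    using adj[OF that] by (auto simp: arcs_ends_def arc_to_ends_def)
  have "adjacency n adj (parcs G)"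
  proof
    show "parcs G \<subseteq> {..<n} \<times> {..<n}" using G.in_arcsD1 G.in_arcsD2 V by auto
    show "sym (parcs G)" using G.sym_arcs by (simp add: symmetric_def)
    show "length (adj v) \<le> 5" if "v < n" for v
    proof -
      have "out_arcs (with_proj G) v = Pair v ` set (adj v)"
        using set_adj[OF that] by (auto simp: out_arcs_def)
      then have "out_degree (with_proj G) v = card (set (adj v))"
        by (simp only: out_degree_def) (simp add: card_image inj_on_def)
      also have "\<dots> = length (adj v)" using adj[OF that] distinct_card by blast
      finally have "out_degree (with_proj G) v = length (adj v)" .
      moreover have "out_degree (with_proj G) v \<le> 5" using assms(2) V that by simp
      ultimately show ?thesis by simp
    qed
  qed (rule set_adj)
  moreover from this have "xs = adjacency.input n adj" using xs by (simp add: adjacency.input_def)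
  ultimately show ?thesis using that by blast
qed

definition word_size :: "nat \<Rightarrow> nat \<Rightarrow> nat" where
  "word_size K n = K + 220 + nat \<lceil>log 2 (real n + 1)\<rceil>"

text \<open>The bound is at most \<open>(K + 220) * (n + 1)\<close>. The constant factor costs a
  constant number of bits, since \<open>K + 220 < 2 ^ (K + 220)\<close>.\<close>

lemma word_size_sufficient: "20 * n + K + 200 < 2 ^ word_size K n"
proof -
  define m where "m = nat \<lceil>log 2 (real n + 1)\<rceil>"
  have "real n + 1 = 2 powr (log 2 (real n + 1))" by simp
  also have "\<dots> \<le> 2 powr real m"
    unfolding m_def by (intro powr_mono) linarith+
  also have "\<dots> = 2 ^ m" by (simp add: powr_realpow)
  finally have "real (n + 1) \<le> real (2 ^ m)" by simp
  then have "n + 1 \<le> 2 ^ m" by (simp only: of_nat_le_iff)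
  moreover have "K + 220 < 2 ^ (K + 220)" by (rule less_exp)
  ultimately have "(K + 220) * (n + 1) < 2 ^ (K + 220) * 2 ^ m"
    by (intro mult_less_le_imp_less) auto
  moreover have "20 * n + K + 200 \<le> (K + 220) * (n + 1)" by (simp add: algebra_simps)
  ultimately show ?thesis by (simp add: word_size_def power_add m_def)
qed

lemma word_size_bigo: "(\<lambda>n. real (word_size K n)) \<in> O(\<lambda>n. ln (real n))"
proof -
  have "real (word_size K n) \<le> real K + 221 + log 2 (real n + 1)" for n
  proof -
    have "0 \<le> log 2 (real n + 1)" by simp
    then show ?thesis unfolding word_size_def by linarith
  qed
  then have "(\<lambda>n. real (word_size K n)) \<in> O(\<lambda>n. real K + 221 + log 2 (real n + 1))"
    by (intro landau_o.big_mono always_eventually allI) (smt (verit) real_norm_def of_nat_0_le_iff)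
  also have "(\<lambda>n. real K + 221 + log 2 (real n + 1)) \<in> O(\<lambda>n. ln (real n))"
    by real_asymp
  finally show ?thesis .
qed

theorem theorem1:
  shows "\<exists>(P :: program) (T :: nat \<Rightarrow> nat) (W :: nat \<Rightarrow> nat).
    (\<lambda>n. real (T n)) \<in> O(\<lambda>n. real n) \<and>
    (\<lambda>n. real (W n)) \<in> O(\<lambda>n. ln (real n)) \<and>
    (\<forall>(n :: nat) (G :: nat pair_pre_digraph) (xs :: nat list).
       pair_graph G \<longrightarrow>
       (\<forall>v\<in>pverts G. out_degree (with_proj G) v \<le> 5) \<longrightarrow>
       adjacency_list_rep n G xs \<longrightarrow>
       decides_within P (W n) (T n) xs (has_square_root G))"
proof -
  \<comment> \<open>The automaton is fixed before \<open>n\<close> and \<open>G\<close>, so one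
    program and one constant \<open>K\<close> serve all inputs.\<close>
  obtain K q0 f g a where A: "root_automaton 72 K q0 f g a"
    using ex_root_automaton[of 72] by auto
  define P where "P = compile 0 (setup_code ;; bfs_code ;; feed_code K q0 f g a)"
  have "decides_within P (word_size K n) ((20 * K + 2600) * (n + 1)) xs (has_square_root G)"
    if G: "pair_graph G" "\<forall>v\<in>pverts G. out_degree (with_proj G) v \<le> 5" "adjacency_list_rep n G xs"
    for n :: nat and G :: "nat pair_pre_digraph" and xs :: "nat list"
  proof -
    obtain adj where "adjacency n adj (parcs G)" and xs: "xs = adjacency.input n adj"
      by (rule adjacency_of_rep[OF G])
    then interpret adjacency n adj "parcs G" by simp
    show ?thesis
      unfolding P_def xs has_square_root_iff[OF G(1)]
    proof (rule wp_decides_within[OF wp_square_root[OF word_size_sufficient A]])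
      fix x assume "x \<in> set input"
      then have "x \<le> n + 5" by (rule input_bound)
      then show "x < 2 ^ word_size K n" using word_size_sufficient[of n K] by linarith
    qed
  qed
  moreover have "(\<lambda>n. real ((20 * K + 2600) * (n + 1))) \<in> O(\<lambda>n. real n)"
    unfolding of_nat_mult of_nat_add of_nat_1 by real_asymp
  ultimately show ?thesis
    using word_size_bigo[of K]
    by (intro exI[of _ P] exI[of _ "\<lambda>n. (20 * K + 2600) * (n + 1)"] exI[of _ "word_size K"]) blast
qed

end
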